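(* Assume that $q$ and $f$ do not depend on the major player's control $\alpha^0$ (write $q(t,i,j,\alpha,i^0,x)$, $f(t,i,\alpha,i^0,x)$). Assume also: (1) for all $i^0\in\{1,\dots,M^0\}$, $(t,x)\in[0,T]\times\mathcal{P}$ and $v^0\in\mathbb{R}^{M^0}$, the function $\alpha^0\mapsto f^0(t,i^0,\alpha^0,x)+\sum_{j^0\ne i^0}(v^0_{j^0}-v^0_{i^0})q^0(t,i^0,j^0,\alpha^0,x)$ has a unique minimizer in $A_0$, denoted $\hat\alpha^0(t,i^0,x,v^0)$, and $\hat\alpha^0$ is Lipschitz in $(t,x,v^0)$ for all $i^0$ with a common Lipschitz constant; (2) for all $i\in\{1,\dots,M\}$, $i^0\in\{1,\dots,M^0\}$, $(t,x)\in[0,T]\times\mathcal{P}$ and $v\in\mathbb{R}^{M\times M^0}$, the function $\alpha\mapsto f(t,i,\alpha,i^0,x)+\sum_{j\ne i}(v_{j,i^0}-v_{i,i^0})q(t,i,j,\alpha,i^0,x)$ has a unique minimizer in $A$, denoted $\hat\alpha(t,i,i^0,x,v)$, and $\hat\alpha$ is Lipschitz in $(t,x,v)$ for all $i,i^0$ with a common Lipschitz constant. Assume that there exist two functions $\hat\phi^0:[0,T]\times\{1,\dots,M^0\}\times\mathcal{P}\to A_0$ and $\hat\phi:[0,T]\times\{1,\dots,M\}\times\{1,\dots,M^0\}\times\mathcal{P}\to A$ such that the system of PDEs in $(v^0,v)$ $$\begin{aligned}&0=[\mathcal{G}^0_{\hat\phi^0,\hat\phi}v^0](t,i^0,x)+f^0(t,i^0,\hat\phi^0(t,i^0,x),x),\qquad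 v^0(T,i^0,x)=g^0(i^0,x),\\&0=[\mathcal{G}_{\hat\phi^0,\hat\phi,\hat\phi}v](t,i,i^0,x)+f(t,i,\hat\phi(t,i,i^0,x),i^0,x),\qquad v(T,i,i^0,x)=g(i,i^0,x),\end{aligned}$$ for all $i\in\{1,\dots,M\}$, $i^0\in\{1,\dots,M^0\}$, $x\in\mathcal{P}$ (and $t\in[0,T]$), admits a classical solution $(\hat V^0,\hat V)$ (i.e. the solutions are $C^1$ in $t$ and $x$). Assume in addition that $$\hat\phi^0(t,i^0,x)=\hat\alpha^0(t,i^0,x,\hat V^0(t,\cdot,x)),\qquad \hat\phi(t,i,i^0,x)=\hat\alpha(t,i,i^0,x,\hat V(t,\cdot,\cdot,x)).$$ Then $\hat\phi^0$ and $\hat\phi$ form a Nash equilibrium of the mean field game, and $\hat V^0(0,X^0_0,\mu_0)$ and $\hat V(0,X_0,X^0_0,\mu_0)$ are the equilibrium expected costs of the major and minor players.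
   Context: Model data. Fix $T>0$, integers $M^0\ge1$, $M\ge2$, convex sets $A_0$ (controls of the major player) and $A$ (controls of the minor players) in normed vector spaces, and $\mathcal{P}=\{x\in\mathbb{R}^{M-1}: x_i\ge0,\ \sum_i x_i\le1\}$. Given are rate functions $q(t,i,j,\alpha,i^0,x)$, $q^0(t,i^0,j^0,\alpha^0,x)$ and real-valued costs $f^0(t,i^0,\alpha^0,x)$, $g^0(i^0,x)$, $f(t,i,\alpha,i^0,x)$, $g(i,i^0,x)$ (where $q,f$ are assumed independent of $\alpha^0$, as stated in the claim), with $t\in[0,T]$, $i,j\in\{1,\dots,M\}$, $i^0,j^0\in\{1,\dots,M^0\}$, $\alpha\in A$, $\alpha^0\in A_0$, $x\in\mathcal{P}$. Standing assumptions. (a) For all values of the other arguments, $[q(t,i,j,\alpha,i^0,x)]_{i,j}$ and $[q^0(t,i^0,j^0,\alpha^0,x)]_{i^0,j^0}$ are Q-matrices (nonnegative off-diagonal entries, zero row sums). (b) There is $L>0$ such that $f,f^0,g,g^0,q,q^0$ are $L$-Lipschitz in $(t,x,\alpha^0,\alpha)$ (in those variables they depend on), uniformly in the discrete variables. (c) $|q|\le C$ for some constant $C$. (d) There is $\epsilon>0$ such that for all $t,\alpha,i^0$ and all $i\ne j$ in $\{1,\dots,M-1\}$: $x_i<\epsilon$ implies $q(t,i,j,\alpha,i^0,x)=0$, and $1-\sum_{k=1}^{M-1}x_k<\epsilon$ implies $q(t,M,i,\alpha,i^0,x)=0$. Feedback functions: $\phi^0:[0,T]\times\{1,\dots,M^0\}\times\mathcal{P}\to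 A_0$ and $\phi,\bar\phi:[0,T]\times\{1,\dots,M\}\times\{1,\dots,M^0\}\times\mathcal{P}\to A$; Lipschitz means Lipschitz in $(t,x)$ uniformly in the discrete variables. Put $q^0_{\phi^0}(t,i^0,j^0,x)=q^0(t,i^0,j^0,\phi^0(t,i^0,x),x)$, $q_\phi(t,i,j,i^0,x)=q(t,i,j,\phi(t,i,i^0,x),i^0,x)$, $f^0_{\phi^0}(t,i^0,x)=f^0(t,i^0,\phi^0(t,i^0,x),x)$, $f_\phi(t,i,i^0,x)=f(t,i,\phi(t,i,i^0,x),i^0,x)$. Operators: $$[\mathcal{G}^0_{\phi^0,\phi}F](t,i^0,x)=\partial_tF+\sum_{j^0\ne i^0}[F(t,j^0,x)-F(t,i^0,x)]q^0_{\phi^0}(t,i^0,j^0,x)+\sum_{k,l=1}^{M-1}\partial_{x_l}F\,x_k\,q_\phi(t,k,l,i^0,x)+\Bigl(1-\sum_{k=1}^{M-1}x_k\Bigr)\sum_{l=1}^{M-1}\partial_{x_l}F\,q_\phi(t,M,l,i^0,x),$$ $$\begin{aligned}[\mathcal{G}_{\phi^0,\phi,\bar\phi}F](t,i,i^0,x)=\;&\partial_tF+\sum_{j^0\ne i^0}[F(t,i,j^0,x)-F(t,i,i^0,x)]q^0_{\phi^0}(t,i^0,j^0,x)+\sum_{j\ne i}[F(t,j,i^0,x)-F(t,i,i^0,x)]q_{\bar\phi}(t,i,j,i^0,x)\\&+\sum_{k,l=1}^{M-1}\partial_{x_l}F\,x_k\,q_\phi(t,k,l,i^0,x)+\Bigl(1-\sum_{k=1}^{M-1}x_k\Bigr)\sum_{l=1}^{M-1}\partial_{x_l}F\,q_\phi(t,M,l,i^0,x).\end{aligned}$$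 For Lipschitz feedback functions let $(X^0_t,\mu_t)$ and $(X_t,X^0_t,\mu_t)$ be the time-inhomogeneous Markov processes with space-time generators $\mathcal{G}^0_{\phi^0,\phi}$ and $\mathcal{G}_{\phi^0,\phi,\bar\phi}$, and set $$J^0_{\phi^0,\phi}(t,i^0,x)=\mathbb{E}\Bigl[\int_t^Tf^0_{\phi^0}(s,X^0_s,\mu_s)ds+g^0(X^0_T,\mu_T)\,\Big|\,X^0_t=i^0,\mu_t=x\Bigr],$$ $$J_{\phi^0,\phi,\bar\phi}(t,i,i^0,x)=\mathbb{E}\Bigl[\int_t^Tf_{\bar\phi}(s,X_s,X^0_s,\mu_s)ds+g(X_T,X^0_T,\mu_T)\,\Big|\,X_t=i,X^0_t=i^0,\mu_t=x\Bigr].$$ A pair $(\hat\phi^0,\hat\phi)$ is a Nash equilibrium of the mean field game if $\hat\phi^0$ is a best response of the major player to $\hat\phi$, i.e. $J^0_{\hat\phi^0,\hat\phi}=\inf_{\phi^0}J^0_{\phi^0,\hat\phi}$, and $\hat\phi$ is a best response of the representative minor player to $(\hat\phi^0,\hat\phi)$, i.e. $J_{\hat\phi^0,\hat\phi,\hat\phi}=\inf_{\bar\phi}J_{\hat\phi^0,\hat\phi,\bar\phi}$, infima being over admissible (Lipschitz) feedback functions. The equilibrium expected costs are $J^0_{\hat\phi^0,\hat\phi}(0,X^0_0,\mu_0)$ and $J_{\hat\phi^0,\hat\phi,\hat\phi}(0,X_0,X^0_0,\mu_0)$. *)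

theory Defs
  imports "HOL-Probability.Probability"
begin

text \<open>
  The minor players' states \<open>1, \<dots>, M\<close> are the elements of \<^typ>\<open>'m::finite option\<close>: \<open>Some k\<close> are the
  states \<open>1, \<dots>, M - 1\<close>, which index the coordinates of \<^typ>\<open>real ^ 'm\<close>, and \<open>None\<close> is the state \<open>M\<close>,
  whose mass is \<open>1 - (\<Sum>k. x $ k)\<close>. The major player's states \<open>1, \<dots>, M\<^sup>0\<close> are those of \<open>'k::finite\<close>.
\<close>

type_synonym ('m, 'k, 'a) feedback0 = "real \<Rightarrow> 'k \<Rightarrow> real ^ 'm \<Rightarrow> 'a"
type_synonym ('m, 'k, 'b) feedback = "real \<Rightarrow> 'm option \<Rightarrow> 'k \<Rightarrow> real ^ 'm \<Rightarrow> 'b"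

definition subsimplex :: "(real ^ 'm::finite) set" where
  "subsimplex = {x. (\<forall>i. 0 \<le> x $ i) \<and> (\<Sum>i\<in>UNIV. x $ i) \<le> 1}"

definition Q_matrix :: "('s::finite \<Rightarrow> 's \<Rightarrow> real) \<Rightarrow> bool" where
  "Q_matrix Q \<longleftrightarrow> (\<forall>i j. i \<noteq> j \<longrightarrow> 0 \<le> Q i j) \<and> (\<forall>i. (\<Sum>j\<in>UNIV. Q i j) = 0)"

locale mfg_data =
  fixes T :: real
    and A0 :: "'a::real_normed_vector set"
    and A :: "'b::real_normed_vector set"
    and q0 :: "real \<Rightarrow> 'k::finite \<Rightarrow> 'k \<Rightarrow> 'a \<Rightarrow> real ^ 'm::finite \<Rightarrow> real"
    and q :: "real \<Rightarrow> 'm option \<Rightarrow> 'm option \<Rightarrow> 'b \<Rightarrow> 'k \<Rightarrow> real ^ 'm \<Rightarrow> real"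
    and f0 :: "real \<Rightarrow> 'k \<Rightarrow> 'a \<Rightarrow> real ^ 'm \<Rightarrow> real"
    and g0 :: "'k \<Rightarrow> real ^ 'm \<Rightarrow> real"
    and f :: "real \<Rightarrow> 'm option \<Rightarrow> 'b \<Rightarrow> 'k \<Rightarrow> real ^ 'm \<Rightarrow> real"
    and g :: "'m option \<Rightarrow> 'k \<Rightarrow> real ^ 'm \<Rightarrow> real"
  assumes T_pos: "0 < T"
    and convex_A0: "convex A0"
    and convex_A: "convex A"
    and Q_matrix_q: "\<And>t \<alpha> i0 x. \<lbrakk>t \<in> {0..T}; \<alpha> \<in> A; x \<in> subsimplex\<rbrakk>
          \<Longrightarrow> Q_matrix (\<lambda>i j. q t i j \<alpha> i0 x)"
    and Q_matrix_q0: "\<And>t \<alpha>0 x. \<lbrakk>t \<in> {0..T}; \<alpha>0 \<in> A0; x \<in> subsimplex\<rbrakk>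
          \<Longrightarrow> Q_matrix (\<lambda>i0 j0. q0 t i0 j0 \<alpha>0 x)"
    and lipschitz: "\<exists>L>0.
          (\<forall>i j i0. L-lipschitz_on ({0..T} \<times> A \<times> subsimplex) (\<lambda>(t, \<alpha>, x). q t i j \<alpha> i0 x)) \<and>
          (\<forall>i0 j0. L-lipschitz_on ({0..T} \<times> A0 \<times> subsimplex) (\<lambda>(t, \<alpha>0, x). q0 t i0 j0 \<alpha>0 x)) \<and>
          (\<forall>i i0. L-lipschitz_on ({0..T} \<times> A \<times> subsimplex) (\<lambda>(t, \<alpha>, x). f t i \<alpha> i0 x)) \<and>
          (\<forall>i0. L-lipschitz_on ({0..T} \<times> A0 \<times> subsimplex) (\<lambda>(t, \<alpha>0, x). f0 t i0 \<alpha>0 x)) \<and>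
          (\<forall>i i0. L-lipschitz_on subsimplex (g i i0)) \<and>
          (\<forall>i0. L-lipschitz_on subsimplex (g0 i0))"
    and q_bounded: "\<exists>C. \<forall>t\<in>{0..T}. \<forall>i j. \<forall>\<alpha>\<in>A. \<forall>i0. \<forall>x\<in>subsimplex. \<bar>q t i j \<alpha> i0 x\<bar> \<le> C"
    and q_boundary: "\<exists>\<epsilon>>0. \<forall>t\<in>{0..T}. \<forall>\<alpha>\<in>A. \<forall>i0. \<forall>x\<in>subsimplex.
          (\<forall>i j. i \<noteq> j \<longrightarrow> x $ i < \<epsilon> \<longrightarrow> q t (Some i) (Some j) \<alpha> i0 x = 0) \<and>
          (1 - (\<Sum>k\<in>UNIV. x $ k) < \<epsilon> \<longrightarrow> (\<forall>i. q t None (Some i) \<alpha> i0 x = 0))"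

definition admissible0 ::
  "real \<Rightarrow> 'a::real_normed_vector set \<Rightarrow> ('m::finite, 'k::finite, 'a) feedback0 set" where
  "admissible0 T A0 = {\<phi>0. (\<forall>t\<in>{0..T}. \<forall>i0. \<forall>x\<in>subsimplex. \<phi>0 t i0 x \<in> A0) \<and>
     (\<exists>K. \<forall>i0. K-lipschitz_on ({0..T} \<times> subsimplex) (\<lambda>(t, x). \<phi>0 t i0 x))}"

definition admissible ::
  "real \<Rightarrow> 'b::real_normed_vector set \<Rightarrow> ('m::finite, 'k::finite, 'b) feedback set" where
  "admissible T A = {\<phi>. (\<forall>t\<in>{0..T}. \<forall>i i0. \<forall>x\<in>subsimplex. \<phi> t i i0 x \<in> A) \<and>
     (\<exists>K. \<forall>i i0. K-lipschitz_on ({0..T} \<times> subsimplex) (\<lambda>(t, x). \<phi> t i i0 x))}"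


text \<open>
  Partial derivatives on the closed set \<open>[0,T] \<times> subsimplex\<close> are components of the Frechet derivative
  within that set, which is unique because the set is convex with nonempty interior. They cannot be
  defined by restricting the function to coordinate lines: at a vertex of the simplex such a line may
  meet the simplex in that vertex only.
\<close>

definition partial_t ::
  "real \<Rightarrow> (real \<Rightarrow> 'd \<Rightarrow> real ^ 'm::finite \<Rightarrow> real) \<Rightarrow> real \<Rightarrow> 'd \<Rightarrow> real ^ 'm \<Rightarrow> real" where
  "partial_t T F t d x =
     frechet_derivative (\<lambda>(s, y). F s d y) (at (t, x) within {0..T} \<times> subsimplex) (1, 0)"

definition partial_x ::
  "real \<Rightarrow> (real \<Rightarrow> 'd \<Rightarrow> real ^ 'm::finite \<Rightarrow> real) \<Rightarrow> 'm \<Rightarrow> real \<Rightarrow> 'd \<Rightarrow> real ^ 'm \<Rightarrow> real" where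
  "partial_x T F l t d x =
     frechet_derivative (\<lambda>(s, y). F s d y) (at (t, x) within {0..T} \<times> subsimplex) (0, axis l 1)"

definition C1 :: "real \<Rightarrow> (real \<Rightarrow> 'd \<Rightarrow> real ^ 'm::finite \<Rightarrow> real) \<Rightarrow> bool" where
  "C1 T F \<longleftrightarrow> (\<forall>d.
     (\<lambda>(t, x). F t d x) differentiable_on ({0..T} \<times> subsimplex) \<and>
     continuous_on ({0..T} \<times> subsimplex) (\<lambda>(t, x). partial_t T F t d x) \<and>
     (\<forall>l. continuous_on ({0..T} \<times> subsimplex) (\<lambda>(t, x). partial_x T F l t d x)))"

definition gen0 ::
  "real \<Rightarrow> (real \<Rightarrow> 'k::finite \<Rightarrow> 'k \<Rightarrow> 'a \<Rightarrow> real ^ 'm::finite \<Rightarrow> real) \<Rightarrow>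
   (real \<Rightarrow> 'm option \<Rightarrow> 'm option \<Rightarrow> 'b \<Rightarrow> 'k \<Rightarrow> real ^ 'm \<Rightarrow> real) \<Rightarrow>
   ('m, 'k, 'a) feedback0 \<Rightarrow> ('m, 'k, 'b) feedback \<Rightarrow>
   (real \<Rightarrow> 'k \<Rightarrow> real ^ 'm \<Rightarrow> real) \<Rightarrow> real \<Rightarrow> 'k \<Rightarrow> real ^ 'm \<Rightarrow> real" where
  "gen0 T q0 q \<phi>0 \<phi> F t i0 x =
     partial_t T F t i0 x
     + (\<Sum>j0\<in>UNIV - {i0}. (F t j0 x - F t i0 x) * q0 t i0 j0 (\<phi>0 t i0 x) x)
     + (\<Sum>k\<in>UNIV. \<Sum>l\<in>UNIV.
          partial_x T F l t i0 x * x $ k * q t (Some k) (Some l) (\<phi> t (Some k) i0 x) i0 x)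
     + (1 - (\<Sum>k\<in>UNIV. x $ k))
       * (\<Sum>l\<in>UNIV. partial_x T F l t i0 x * q t None (Some l) (\<phi> t None i0 x) i0 x)"

fun gen ::
  "real \<Rightarrow> (real \<Rightarrow> 'k::finite \<Rightarrow> 'k \<Rightarrow> 'a \<Rightarrow> real ^ 'm::finite \<Rightarrow> real) \<Rightarrow>
   (real \<Rightarrow> 'm option \<Rightarrow> 'm option \<Rightarrow> 'b \<Rightarrow> 'k \<Rightarrow> real ^ 'm \<Rightarrow> real) \<Rightarrow>
   ('m, 'k, 'a) feedback0 \<Rightarrow> ('m, 'k, 'b) feedback \<Rightarrow> ('m, 'k, 'b) feedback \<Rightarrow>
   (real \<Rightarrow> 'm option \<times> 'k \<Rightarrow> real ^ 'm \<Rightarrow> real) \<Rightarrow>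
   real \<Rightarrow> 'm option \<times> 'k \<Rightarrow> real ^ 'm \<Rightarrow> real" where
  "gen T q0 q \<phi>0 \<phi> \<phi>b F t (i, i0) x =
     partial_t T F t (i, i0) x
     + (\<Sum>j0\<in>UNIV - {i0}. (F t (i, j0) x - F t (i, i0) x) * q0 t i0 j0 (\<phi>0 t i0 x) x)
     + (\<Sum>j\<in>UNIV - {i}. (F t (j, i0) x - F t (i, i0) x) * q t i j (\<phi>b t i i0 x) i0 x)
     + (\<Sum>k\<in>UNIV. \<Sum>l\<in>UNIV.
          partial_x T F l t (i, i0) x * x $ k * q t (Some k) (Some l) (\<phi> t (Some k) i0 x) i0 x)
     + (1 - (\<Sum>k\<in>UNIV. x $ k))
       * (\<Sum>l\<in>UNIV. partial_x T F l t (i, i0) x * q t None (Some l) (\<phi> t None i0 x) i0 x)"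


text \<open>
  A time-inhomogeneous Markov process on \<open>[0,T]\<close> with a finite component \<open>'d\<close> and a component in the
  simplex is given by its coordinates \<open>Z s\<close> and by the laws \<open>Pr t z\<close> under which it starts from the
  state \<open>z\<close> at time \<open>t\<close>, so that the conditional expectation given \<open>Z t = z\<close> is the expectation under
  \<open>Pr t z\<close>. Path regularity is required only in the form of joint measurability in time and
  \<open>\<omega>\<close> (which right-continuous paths imply), as needed for integrals over time.
\<close>

definition state_algebra :: "('d::finite \<times> (real ^ 'm::finite)) measure" where
  "state_algebra = restrict_space (count_space UNIV \<Otimes>\<^sub>M borel) (UNIV \<times> subsimplex)"

definition past :: "'w measure \<Rightarrow> (real \<Rightarrow> 'w \<Rightarrow> 'd::finite \<times> (real ^ 'm::finite)) \<Rightarrow>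
    real \<Rightarrow> real \<Rightarrow> 'w measure" where
  "past W Z t s =
     sigma (space W) {Z r -` B \<inter> space W | r B. r \<in> {t..s} \<and> B \<in> sets state_algebra}"

definition markov_process ::
  "real \<Rightarrow> (real \<Rightarrow> 'd::finite \<times> (real ^ 'm::finite) \<Rightarrow> 'w measure) \<Rightarrow>
   (real \<Rightarrow> 'w \<Rightarrow> 'd \<times> (real ^ 'm)) \<Rightarrow> bool" where
  "markov_process T Pr Z \<longleftrightarrow>
     (\<forall>t\<in>{0..T}. \<forall>z\<in>UNIV \<times> subsimplex.
        prob_space (Pr t z) \<and>
        (\<lambda>(s, \<omega>). Z s \<omega>) \<in> restrict_space borel {t..T} \<Otimes>\<^sub>M Pr t z \<rightarrow>\<^sub>M state_algebra \<and>
        (AE \<omega> in Pr t z. Z t \<omega> = z)) \<and>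
     (\<forall>s u h. 0 \<le> s \<and> s \<le> u \<and> u \<le> T \<and> h \<in> borel_measurable state_algebra \<and>
          bounded (h ` (UNIV \<times> subsimplex)) \<longrightarrow>
        (\<lambda>z. \<integral>\<omega>. h (Z u \<omega>) \<partial>Pr s z :: real) \<in> borel_measurable state_algebra \<and>
        (\<forall>t\<in>{0..s}. \<forall>z\<in>UNIV \<times> subsimplex. AE \<omega> in Pr t z.
           real_cond_exp (Pr t z) (past (Pr t z) Z t s) (\<lambda>\<omega>'. h (Z u \<omega>')) \<omega>
             = (\<integral>\<omega>'. h (Z u \<omega>') \<partial>Pr s (Z s \<omega>))))"

text \<open>
  The space-time generator is the derivative at \<open>h = 0\<close> of the semigroup of the process \<open>(t, Z t)\<close>, in
  the supremum norm, on \<open>C1\<close> functions.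
\<close>

definition has_space_time_generator ::
  "real \<Rightarrow> (real \<Rightarrow> 'd::finite \<times> (real ^ 'm::finite) \<Rightarrow> 'w measure) \<Rightarrow>
   (real \<Rightarrow> 'w \<Rightarrow> 'd \<times> (real ^ 'm)) \<Rightarrow>
   ((real \<Rightarrow> 'd \<Rightarrow> real ^ 'm \<Rightarrow> real) \<Rightarrow> real \<Rightarrow> 'd \<Rightarrow> real ^ 'm \<Rightarrow> real) \<Rightarrow> bool" where
  "has_space_time_generator T Pr Z G \<longleftrightarrow>
     (\<forall>F. C1 T F \<longrightarrow> (\<forall>\<epsilon>>0. \<exists>\<delta>>0. \<forall>h t d x.
        0 < h \<and> h < \<delta> \<and> 0 \<le> t \<and> t + h \<le> T \<and> x \<in> subsimplex \<longrightarrow>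
        \<bar>((\<integral>\<omega>. F (t + h) (fst (Z (t + h) \<omega>)) (snd (Z (t + h) \<omega>)) \<partial>Pr t (d, x)) - F t d x) / h
          - G F t d x\<bar> < \<epsilon>))"


text \<open>
  The families \<open>Pr\<close> and \<open>Z\<close> of laws and coordinates are indexed by the feedback functions in use; in
  \<open>cost\<close> the state of the process is \<open>((X, X\<^sup>0), \<mu>)\<close>.
\<close>

definition cost0 ::
  "real \<Rightarrow> (real \<Rightarrow> 'k::finite \<Rightarrow> 'a \<Rightarrow> real ^ 'm::finite \<Rightarrow> real) \<Rightarrow> ('k \<Rightarrow> real ^ 'm \<Rightarrow> real) \<Rightarrow>
   (('m, 'k, 'a) feedback0 \<Rightarrow> ('m, 'k, 'b) feedback \<Rightarrow> real \<Rightarrow> 'k \<times> (real ^ 'm) \<Rightarrow> 'w measure) \<Rightarrow>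
   (('m, 'k, 'a) feedback0 \<Rightarrow> ('m, 'k, 'b) feedback \<Rightarrow> real \<Rightarrow> 'w \<Rightarrow> 'k \<times> (real ^ 'm)) \<Rightarrow>
   ('m, 'k, 'a) feedback0 \<Rightarrow> ('m, 'k, 'b) feedback \<Rightarrow> real \<Rightarrow> 'k \<Rightarrow> real ^ 'm \<Rightarrow> real" where
  "cost0 T f0 g0 Pr Z \<phi>0 \<phi> t i0 x =
     (\<integral>\<omega>. (LINT s:{t..T}|lborel.
              (case Z \<phi>0 \<phi> s \<omega> of (j0, y) \<Rightarrow> f0 s j0 (\<phi>0 s j0 y) y))
            + (case Z \<phi>0 \<phi> T \<omega> of (j0, y) \<Rightarrow> g0 j0 y) \<partial>Pr \<phi>0 \<phi> t (i0, x))"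

definition cost ::
  "real \<Rightarrow> (real \<Rightarrow> 'm::finite option \<Rightarrow> 'b \<Rightarrow> 'k::finite \<Rightarrow> real ^ 'm \<Rightarrow> real) \<Rightarrow>
   ('m option \<Rightarrow> 'k \<Rightarrow> real ^ 'm \<Rightarrow> real) \<Rightarrow>
   (('m, 'k, 'a) feedback0 \<Rightarrow> ('m, 'k, 'b) feedback \<Rightarrow> ('m, 'k, 'b) feedback \<Rightarrow>
      real \<Rightarrow> ('m option \<times> 'k) \<times> (real ^ 'm) \<Rightarrow> 'w measure) \<Rightarrow>
   (('m, 'k, 'a) feedback0 \<Rightarrow> ('m, 'k, 'b) feedback \<Rightarrow> ('m, 'k, 'b) feedback \<Rightarrow>
      real \<Rightarrow> 'w \<Rightarrow> ('m option \<times> 'k) \<times> (real ^ 'm)) \<Rightarrow>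
   ('m, 'k, 'a) feedback0 \<Rightarrow> ('m, 'k, 'b) feedback \<Rightarrow> ('m, 'k, 'b) feedback \<Rightarrow>
   real \<Rightarrow> 'm option \<Rightarrow> 'k \<Rightarrow> real ^ 'm \<Rightarrow> real" where
  "cost T f g Pr Z \<phi>0 \<phi> \<phi>b t i i0 x =
     (\<integral>\<omega>. (LINT s:{t..T}|lborel.
              (case Z \<phi>0 \<phi> \<phi>b s \<omega> of ((j, j0), y) \<Rightarrow> f s j (\<phi>b s j j0 y) j0 y))
            + (case Z \<phi>0 \<phi> \<phi>b T \<omega> of ((j, j0), y) \<Rightarrow> g j j0 y) \<partial>Pr \<phi>0 \<phi> \<phi>b t ((i, i0), x))"

text \<open>The infima are taken in the extended reals, where they always exist.\<close>

definition nash_equilibrium ::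
  "real \<Rightarrow> 'a::real_normed_vector set \<Rightarrow> 'b::real_normed_vector set \<Rightarrow>
   (('m::finite, 'k::finite, 'a) feedback0 \<Rightarrow> ('m, 'k, 'b) feedback \<Rightarrow>
      real \<Rightarrow> 'k \<Rightarrow> real ^ 'm \<Rightarrow> real) \<Rightarrow>
   (('m, 'k, 'a) feedback0 \<Rightarrow> ('m, 'k, 'b) feedback \<Rightarrow> ('m, 'k, 'b) feedback \<Rightarrow>
      real \<Rightarrow> 'm option \<Rightarrow> 'k \<Rightarrow> real ^ 'm \<Rightarrow> real) \<Rightarrow>
   ('m, 'k, 'a) feedback0 \<Rightarrow> ('m, 'k, 'b) feedback \<Rightarrow> bool" where
  "nash_equilibrium T A0 A J0 J \<phi>0 \<phi> \<longleftrightarrow>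
     \<phi>0 \<in> admissible0 T A0 \<and> \<phi> \<in> admissible T A \<and>
     (\<forall>t\<in>{0..T}. \<forall>i0. \<forall>x\<in>subsimplex.
        ereal (J0 \<phi>0 \<phi> t i0 x) = (INF \<psi>0\<in>admissible0 T A0. ereal (J0 \<psi>0 \<phi> t i0 x))) \<and>
     (\<forall>t\<in>{0..T}. \<forall>i i0. \<forall>x\<in>subsimplex.
        ereal (J \<phi>0 \<phi> \<phi> t i i0 x) = (INF \<psi>\<in>admissible T A. ereal (J \<phi>0 \<phi> \<psi> t i i0 x)))"


definition hamiltonian0 ::
  "(real \<Rightarrow> 'k::finite \<Rightarrow> 'k \<Rightarrow> 'a \<Rightarrow> real ^ 'm::finite \<Rightarrow> real) \<Rightarrow>
   (real \<Rightarrow> 'k \<Rightarrow> 'a \<Rightarrow> real ^ 'm \<Rightarrow> real) \<Rightarrow>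
   real \<Rightarrow> 'k \<Rightarrow> real ^ 'm \<Rightarrow> real ^ 'k \<Rightarrow> 'a \<Rightarrow> real" where
  "hamiltonian0 q0 f0 t i0 x v0 \<alpha>0 =
     f0 t i0 \<alpha>0 x + (\<Sum>j0\<in>UNIV - {i0}. (v0 $ j0 - v0 $ i0) * q0 t i0 j0 \<alpha>0 x)"

definition hamiltonian ::
  "(real \<Rightarrow> 'm::finite option \<Rightarrow> 'm option \<Rightarrow> 'b \<Rightarrow> 'k::finite \<Rightarrow> real ^ 'm \<Rightarrow> real) \<Rightarrow>
   (real \<Rightarrow> 'm option \<Rightarrow> 'b \<Rightarrow> 'k \<Rightarrow> real ^ 'm \<Rightarrow> real) \<Rightarrow>
   real \<Rightarrow> 'm option \<Rightarrow> 'k \<Rightarrow> real ^ 'm \<Rightarrow> real ^ 'k ^ ('m option) \<Rightarrow> 'b \<Rightarrow> real" where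
  "hamiltonian q f t i i0 x v \<alpha> =
     f t i \<alpha> i0 x + (\<Sum>j\<in>UNIV - {i}. (v $ j $ i0 - v $ i $ i0) * q t i j \<alpha> i0 x)"

definition alpha_hat0 where
  "alpha_hat0 A0 q0 f0 t i0 x v0 = arg_min_on (hamiltonian0 q0 f0 t i0 x v0) A0"

definition alpha_hat where
  "alpha_hat A q f t i i0 x v = arg_min_on (hamiltonian q f t i i0 x v) A"

end

theory Submission
  imports Defs
begin

text \<open>
  This is a verification argument. Fix all feedbacks and let \<open>G\<close> be the generator of the resulting
  process of the player under consideration, \<open>c\<close> the running cost and \<open>F\<close> a \<open>C1\<close> function that equals the terminal cost at
  time \<open>T\<close>. Dynkin's formula gives
  \<open>cost = F(t, z) + E \<integral>\<^sub>t\<^sup>T (G F + c)(s, Z s) ds\<close> (\<open>cost_representation\<close>).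
  For the candidate feedbacks the differential equations say \<open>G F + c = 0\<close>, so the value functions
  \<open>V0\<close>, \<open>V\<close> are the costs. If a player deviates while the others keep their feedbacks, \<open>G F + c\<close>
  changes by the difference of the player's Hamiltonian at the new and at the old control
  (\<open>gen0_change_control\<close>, \<open>gen_change_control\<close>), which is nonnegative because the old control is the
  minimizer; so the deviation costs at least \<open>V0\<close> or \<open>V\<close>, and the infimum over all feedbacks is
  attained at the candidate.

  Two points need work. First, Dynkin's formula has to come from the generator as a uniform limit of
  difference quotients of the semigroup: the Markov property carries the limit from deterministic to
  random starting states, and \<open>has_integral_uniform_right_derivative\<close> turns the resulting one-sided
  derivative into an integral. Second, the candidate feedbacks must be admissible, that is Lipschitz:
  they compose the Lipschitz minimizers with the value functions, which are Lipschitz because they are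
  \<open>C1\<close> on a compact convex set.
\<close>

section \<open>Integrating a uniform right derivative\<close>

text \<open>
  The fundamental theorem of calculus when only right difference quotients are controlled. Their
  uniform convergence yields what is missing: with the bound on \<open>w\<close> it makes \<open>u\<close> continuous up to both
  end points, so \<open>w\<close> is continuous on \<open>[a, b)\<close> as a locally uniform limit of continuous functions,
  and then the left difference quotient at \<open>x\<close>, which is a right difference quotient at a point near
  \<open>x\<close>, has the limit \<open>w x\<close> as well.
\<close>

lemma has_integral_uniform_right_derivative:
  fixes u w :: "real \<Rightarrow> real"
  assumes "a \<le> b"
    and bound: "\<And>s. s \<in> {a..b} \<Longrightarrow> \<bar>w s\<bar> \<le> B"
    and unif: "\<And>e. 0 < e \<Longrightarrow> \<exists>\<delta>>0. \<forall>h s. 0 < h \<and> h < \<delta> \<and> a \<le> s \<and> s + h \<le> b \<longrightarrow>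
                 \<bar>(u (s + h) - u s) / h - w s\<bar> \<le> e"
  shows "(w has_integral u b - u a) {a..b}"
proof (rule fundamental_theorem_of_calculus_interior[OF \<open>a \<le> b\<close>])
  obtain \<delta> where \<delta>: "0 < \<delta>"
    "\<And>h s. \<lbrakk>0 < h; h < \<delta>; a \<le> s; s + h \<le> b\<rbrakk> \<Longrightarrow> \<bar>(u (s + h) - u s) / h - w s\<bar> \<le> 1"
    using unif[of 1] by auto
  have step: "\<bar>u r - u s\<bar> \<le> (\<bar>B\<bar> + 1) * (r - s)" if "a \<le> s" "s < r" "r \<le> b" "r - s < \<delta>" for r s
  proof -
    have "\<bar>(u r - u s) / (r - s) - w s\<bar> \<le> 1"
      using \<delta>(2)[of "r - s" s] that by simp
    moreover have "\<bar>w s\<bar> \<le> \<bar>B\<bar>" using bound[of s] that by simp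
    ultimately have "\<bar>(u r - u s) / (r - s)\<bar> \<le> \<bar>B\<bar> + 1" by linarith
    then show ?thesis using that by (simp add: abs_divide pos_divide_le_eq)
  qed
  show cont_u: "continuous_on {a..b} u"
    unfolding continuous_on_iff
  proof (intro ballI allI impI)
    fix s e :: real assume s: "s \<in> {a..b}" and "0 < e"
    let ?d = "min \<delta> (e / (\<bar>B\<bar> + 1))"
    show "\<exists>d>0. \<forall>r\<in>{a..b}. dist r s < d \<longrightarrow> dist (u r) (u s) < e"
    proof (intro exI[of _ ?d] conjI ballI impI)
      show "0 < ?d" using \<delta> \<open>0 < e\<close> by simp
      fix r assume r: "r \<in> {a..b}" "dist r s < ?d"
      then have d: "\<bar>r - s\<bar> < \<delta>" "(\<bar>B\<bar> + 1) * \<bar>r - s\<bar> < e"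
        by (auto simp: dist_real_def pos_less_divide_eq mult.commute)
      consider "r = s" | "s < r" | "r < s" by linarith
      then have "\<bar>u r - u s\<bar> \<le> (\<bar>B\<bar> + 1) * \<bar>r - s\<bar>"
      proof cases
        case 2 then show ?thesis using step[of s r] r s d by auto
      next
        case 3 then show ?thesis using step[of r s] r s d by (auto simp: abs_minus_commute)
      qed simp
      then show "dist (u r) (u s) < e" using d by (simp add: dist_real_def)
    qed
  qed
  fix x assume x: "x \<in> {a<..<b}"
  \<comment> \<open>A right difference quotient needs room on the right, so continuity of \<open>w\<close> at \<open>x\<close> is proved on an
    interval that stops at a point \<open>c\<close> before \<open>b\<close>.\<close>
  define c where "c = (x + b) / 2"
  have c: "x < c" "c < b" using x by (auto simp: c_def)
  have "continuous_on {a..c} w"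
  proof (rule uniform_limit_theorem)
    show "uniform_limit {a..c} (\<lambda>h s. (u (s + h) - u s) / h) w (at_right 0)"
      unfolding uniform_limit_iff
    proof (intro allI impI)
      fix e :: real assume "0 < e"
      then obtain d where d: "0 < d" "\<And>h s. \<lbrakk>0 < h; h < d; a \<le> s; s + h \<le> b\<rbrakk> \<Longrightarrow>
                 \<bar>(u (s + h) - u s) / h - w s\<bar> \<le> e / 2"
        using unif[of "e/2"] by auto
      show "\<forall>\<^sub>F h in at_right 0. \<forall>s\<in>{a..c}. dist ((u (s + h) - u s) / h) (w s) < e"
        unfolding eventually_at_right[OF zero_less_one]
      proof (intro exI[of _ "min d (b - c)"] conjI allI impI ballI)
        fix h s assume h: "0 < h" "h < min d (b - c)" and s: "s \<in> {a..c}"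
        then have "\<bar>(u (s + h) - u s) / h - w s\<bar> \<le> e / 2" by (intro d) auto
        then show "dist ((u (s + h) - u s) / h) (w s) < e" using \<open>0 < e\<close> by (simp add: dist_real_def)
      qed (use d c in auto)
    qed
    show "\<forall>\<^sub>F h in at_right 0. continuous_on {a..c} (\<lambda>s. (u (s + h) - u s) / h)"
      unfolding eventually_at_right[OF zero_less_one]
    proof (intro exI[of _ "b - c"] conjI allI impI)
      fix h assume h: "0 < h" "h < b - c"
      have "continuous_on {a..c} (\<lambda>s. u (s + h))"
        by (rule continuous_on_compose2[OF cont_u]) (use h in \<open>auto intro!: continuous_intros\<close>)
      moreover have "continuous_on {a..c} u"
        by (rule continuous_on_subset[OF cont_u]) (use c in auto)
      ultimately show "continuous_on {a..c} (\<lambda>s. (u (s + h) - u s) / h)"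
        using h by (intro continuous_intros) auto
    qed (use c in auto)
  qed simp
  then have "continuous_on {a<..<c} w" by (rule continuous_on_subset) auto
  then have "isCont w x" using x c by (simp add: continuous_on_eq_continuous_at)
  have "(u has_field_derivative w x) (at x)"
    unfolding has_field_derivative_iff tendsto_iff
  proof (intro allI impI)
    fix e :: real assume "0 < e"
    obtain d where d: "0 < d" "\<And>h s. \<lbrakk>0 < h; h < d; a \<le> s; s + h \<le> b\<rbrakk> \<Longrightarrow>
               \<bar>(u (s + h) - u s) / h - w s\<bar> \<le> e / 2"
      using unif[of "e/2"] \<open>0 < e\<close> by auto
    obtain d' where d': "0 < d'" "\<And>y. \<bar>y - x\<bar> < d' \<Longrightarrow> \<bar>w y - w x\<bar> < e / 2"
      using \<open>isCont w x\<close> \<open>0 < e\<close> unfolding continuous_at_eps_delta dist_real_def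
      by (metis half_gt_zero)
    show "\<forall>\<^sub>F y in at x. dist ((u y - u x) / (y - x)) (w x) < e"
      unfolding eventually_at
    proof (intro exI[of _ "Min {d, d', x - a, b - x}"] conjI ballI impI)
      fix y assume y: "y \<noteq> x \<and> dist y x < Min {d, d', x - a, b - x}"
      then have y': "\<bar>y - x\<bar> < d" "\<bar>y - x\<bar> < d'" "a \<le> y" "y \<le> b"
        by (auto simp: dist_real_def)
      have "\<bar>(u y - u x) / (y - x) - w x\<bar> < e"
      proof (cases "x < y")
        case True
        then show ?thesis using d(2)[of "y - x" x] y' x \<open>0 < e\<close> by auto
      next
        case False
        then have "y < x" using y by simp
        \<comment> \<open>The quotient on the left of \<open>x\<close> is a right difference quotient at \<open>y\<close>, hence near \<open>w y\<close>.\<close>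
        have "(u y - u x) / (y - x) = (u (y + (x - y)) - u y) / (x - y)"
          using \<open>y < x\<close> by (simp add: divide_simps) (simp add: algebra_simps)
        moreover have "\<bar>(u (y + (x - y)) - u y) / (x - y) - w y\<bar> \<le> e / 2"
          using y' x \<open>y < x\<close> by (intro d(2)) auto
        ultimately show ?thesis using d'(2)[OF y'(2)] by linarith
      qed
      then show "dist ((u y - u x) / (y - x)) (w x) < e" by (simp add: dist_real_def)
    qed (use d d' x in auto)
  qed
  then show "(u has_vector_derivative w x) (at x)"
    by (simp add: has_real_derivative_iff_has_vector_derivative)
qed

section \<open>Functions on time and state\<close>

text \<open>
  The common regularity class of value functions, generators and running costs along Lipschitz
  feedbacks. Compactness of \<open>[0,T] \<times> subsimplex\<close> makes its members bounded, and they are jointly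
  measurable, which is all that the expectations and Fubini's theorem below require.
\<close>

definition continuous_state_fun ::
  "real \<Rightarrow> (real \<Rightarrow> 'd \<Rightarrow> real ^ 'm::finite \<Rightarrow> real) \<Rightarrow> bool" where
  "continuous_state_fun T F \<longleftrightarrow>
     (\<forall>d. continuous_on ({0..T} \<times> subsimplex) (\<lambda>(t, x). F t d x))"

lemma compact_subsimplex: "compact (subsimplex :: (real ^ 'm::finite) set)"
proof -
  have eq: "(subsimplex :: (real ^ 'm) set) =
      (\<Inter>i. {x. 0 \<le> x $ i}) \<inter> {x. (\<Sum>i\<in>UNIV. x $ i) \<le> 1}"
    by (auto simp: subsimplex_def)
  have "closed (subsimplex :: (real ^ 'm) set)"
    unfolding eq by (intro closed_Int closed_INT ballI closed_Collect_le continuous_intros)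
  moreover have "bounded (subsimplex :: (real ^ 'm) set)"
  proof (rule boundedI)
    fix x :: "real ^ 'm" assume "x \<in> subsimplex"
    then show "norm x \<le> 1"
      using norm_le_l1_cart[of x] by (simp add: subsimplex_def)
  qed
  ultimately show ?thesis by (simp add: compact_eq_bounded_closed)
qed

lemma convex_subsimplex: "convex (subsimplex :: (real ^ 'm::finite) set)"
proof -
  have eq: "(subsimplex :: (real ^ 'm) set) =
      (\<Inter>i. {x. axis i 1 \<bullet> x \<ge> 0}) \<inter> {x. (\<Sum>i\<in>UNIV. axis i 1) \<bullet> x \<le> 1}"
    by (auto simp: subsimplex_def inner_axis' inner_sum_left)
  show ?thesis
    unfolding eq by (intro convex_Int convex_INT convex_halfspace_le convex_halfspace_ge)
qed

lemma compact_time_simplex: "compact ({0..T::real} \<times> (subsimplex :: (real ^ 'm::finite) set))"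
  by (intro compact_Times compact_subsimplex) simp

lemma continuous_state_fun_bounded:
  fixes F :: "real \<Rightarrow> 'd::finite \<Rightarrow> real ^ 'm::finite \<Rightarrow> real"
  assumes "continuous_state_fun T F"
  obtains B where "\<And>t d x. t \<in> {0..T} \<Longrightarrow> x \<in> subsimplex \<Longrightarrow> \<bar>F t d x\<bar> \<le> B"
proof -
  have "\<forall>d. \<exists>B. \<forall>(t, x) \<in> {0..T} \<times> subsimplex. \<bar>F t d x\<bar> \<le> B"
  proof
    fix d
    have "bounded ((\<lambda>(t, x). F t d x) ` ({0..T} \<times> subsimplex))"
      using assms by (intro compact_imp_bounded compact_continuous_image compact_time_simplex)
        (simp add: continuous_state_fun_def)
    then show "\<exists>B. \<forall>(t, x) \<in> {0..T} \<times> subsimplex. \<bar>F t d x\<bar> \<le> B"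
      by (fastforce simp: bounded_iff)
  qed
  then obtain B where B: "\<And>d t x. t \<in> {0..T} \<Longrightarrow> x \<in> subsimplex \<Longrightarrow> \<bar>F t d x\<bar> \<le> B d"
    by (metis (no_types, lifting) case_prodD mem_Sigma_iff)
  show ?thesis
  proof (rule that)
    fix t d and x :: "real ^ 'm" assume "t \<in> {0..T}" "x \<in> subsimplex"
    then have "\<bar>F t d x\<bar> \<le> B d" by (rule B)
    also have "B d \<le> (MAX d. B d)" by simp
    finally show "\<bar>F t d x\<bar> \<le> (MAX d. B d)" .
  qed
qed

text \<open>
  Outside \<open>[0,T] \<times> subsimplex\<close> nothing is known about \<open>F\<close>; the indicator extends it by \<open>0\<close> to a function
  that is measurable on the whole space, which can then be composed with random variables.
\<close>

lemma continuous_state_fun_measurable: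
  fixes F :: "real \<Rightarrow> 'd::finite \<Rightarrow> real ^ 'm::finite \<Rightarrow> real"
  assumes "continuous_state_fun T F"
  shows "(\<lambda>p. indicator ({0..T} \<times> subsimplex) (fst p, snd (snd p)) *
            F (fst p) (fst (snd p)) (snd (snd p)))
         \<in> borel_measurable (borel \<Otimes>\<^sub>M (count_space UNIV \<Otimes>\<^sub>M borel))"
proof (rule measurable_compose_countable'[where I = UNIV and g = "\<lambda>p. fst (snd p)" and
        f = "\<lambda>d p. indicator ({0..T} \<times> subsimplex) (fst p, snd (snd p)) *
            F (fst p) d (snd (snd p))"])
  fix d
  have meas: "(\<lambda>p. indicator ({0..T} \<times> subsimplex) p *\<^sub>R (\<lambda>(t, x). F t d x) p)
      \<in> borel_measurable borel"
    using assms
    by (intro borel_measurable_continuous_on_indicator borel_closed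
        compact_imp_closed[OF compact_time_simplex]) (simp add: continuous_state_fun_def)
  have "(\<lambda>p. (fst p, snd (snd p)))
      \<in> (borel \<Otimes>\<^sub>M (count_space UNIV \<Otimes>\<^sub>M borel) :: (real \<times> 'd \<times> (real ^ 'm)) measure) \<rightarrow>\<^sub>M borel"
    by (intro borel_measurable_Pair) measurable
  from measurable_compose[OF this meas]
  show "(\<lambda>p :: real \<times> 'd \<times> (real ^ 'm).
        indicator ({0..T} \<times> subsimplex) (fst p, snd (snd p)) * F (fst p) d (snd (snd p)))
      \<in> borel_measurable (borel \<Otimes>\<^sub>M (count_space UNIV \<Otimes>\<^sub>M borel))"
    by (simp add: case_prod_beta)
qed simp_all

lemma space_state_algebra [simp]: "space state_algebra = UNIV \<times> subsimplex"
  by (auto simp: state_algebra_def space_restrict_space space_pair_measure)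

lemma measurable_ident_state_algebra:
  "(\<lambda>z. z) \<in> state_algebra \<rightarrow>\<^sub>M (count_space UNIV \<Otimes>\<^sub>M borel)"
  unfolding state_algebra_def by (intro measurable_restrict_space1 measurable_ident_sets refl)

lemma continuous_state_fun_slice_measurable:
  fixes F :: "real \<Rightarrow> 'd::finite \<Rightarrow> real ^ 'm::finite \<Rightarrow> real"
  assumes F: "continuous_state_fun T F" and s: "s \<in> {0..T}"
  shows "(\<lambda>z. F s (fst z) (snd z)) \<in> borel_measurable state_algebra"
proof -
  have "(\<lambda>z. (s, z)) \<in> state_algebra \<rightarrow>\<^sub>M
      (borel \<Otimes>\<^sub>M (count_space UNIV \<Otimes>\<^sub>M borel) :: (real \<times> 'd \<times> (real ^ 'm)) measure)"
    by (intro measurable_Pair measurable_ident_state_algebra measurable_const) simp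
  from measurable_compose[OF this continuous_state_fun_measurable[OF F]]
  show ?thesis
    by (rule measurable_cong[THEN iffD1, rotated]) (use s in auto)
qed

lemma C1_continuous:
  assumes "C1 T F"
  shows "continuous_state_fun T F" "continuous_state_fun T (partial_t T F)"
    "continuous_state_fun T (partial_x T F l)"
  using assms by (auto simp: C1_def continuous_state_fun_def intro: differentiable_imp_continuous_on)

lemma continuous_on_time_simplex:
  "continuous_state_fun T F \<Longrightarrow>
     continuous_on ({0..T} \<times> subsimplex) (\<lambda>p. F (fst p) d (snd p))"
  by (simp add: continuous_state_fun_def case_prod_beta)

section \<open>Markov families and Dynkin's formula\<close>

locale markov_family =
  fixes T :: real
    and Pr :: "real \<Rightarrow> 'd::finite \<times> (real ^ 'm::finite) \<Rightarrow> 'w measure"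
    and Z :: "real \<Rightarrow> 'w \<Rightarrow> 'd \<times> (real ^ 'm)"
  assumes markov: "markov_process T Pr Z"
begin

definition mean :: "(real \<Rightarrow> 'd \<Rightarrow> real ^ 'm \<Rightarrow> real) \<Rightarrow> real \<Rightarrow> 'd \<times> (real ^ 'm) \<Rightarrow> real \<Rightarrow> real" where
  "mean F t z s = (\<integral>\<omega>. F s (fst (Z s \<omega>)) (snd (Z s \<omega>)) \<partial>Pr t z)"

context
  fixes t :: real and z :: "'d \<times> (real ^ 'm)"
  assumes t: "t \<in> {0..T}" and z: "z \<in> UNIV \<times> subsimplex"
begin

lemma prob_space_law: "prob_space (Pr t z)"
  and joint_measurable:
    "(\<lambda>(s, \<omega>). Z s \<omega>) \<in> restrict_space borel {t..T} \<Otimes>\<^sub>M Pr t z \<rightarrow>\<^sub>M state_algebra"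
  and start: "AE \<omega> in Pr t z. Z t \<omega> = z"
  using markov t z unfolding markov_process_def by blast+

lemma coordinate_measurable:
  assumes "s \<in> {t..T}" shows "Z s \<in> Pr t z \<rightarrow>\<^sub>M state_algebra"
  using measurable_Pair2[OF joint_measurable, of s] assms by (simp add: space_restrict_space)

lemma coordinate_in_subsimplex:
  assumes "s \<in> {t..T}" "\<omega> \<in> space (Pr t z)" shows "snd (Z s \<omega>) \<in> subsimplex"
  using measurable_space[OF coordinate_measurable[OF assms(1)] assms(2)] by auto

lemma path_measurable:
  assumes F: "continuous_state_fun T F"
  shows "(\<lambda>(s, \<omega>). F s (fst (Z s \<omega>)) (snd (Z s \<omega>)))
      \<in> borel_measurable (restrict_space borel {t..T} \<Otimes>\<^sub>M Pr t z)"
proof -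
  let ?N = "restrict_space borel {t..T} \<Otimes>\<^sub>M Pr t z"
  have "(\<lambda>p. (\<lambda>(s, \<omega>). Z s \<omega>) p) \<in> ?N \<rightarrow>\<^sub>M (count_space UNIV \<Otimes>\<^sub>M borel)"
    by (rule measurable_compose[OF joint_measurable measurable_ident_state_algebra])
  moreover have "fst \<in> ?N \<rightarrow>\<^sub>M borel"
    by (rule measurable_compose[OF measurable_fst]) (intro measurable_restrict_space1 measurable_ident_sets refl)
  ultimately have "(\<lambda>p. (fst p, Z (fst p) (snd p))) \<in> ?N \<rightarrow>\<^sub>M
      (borel \<Otimes>\<^sub>M (count_space UNIV \<Otimes>\<^sub>M borel))"
    by (simp add: case_prod_beta)
  from measurable_compose[OF this continuous_state_fun_measurable[OF F]]
  show ?thesis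
    by (rule measurable_cong[THEN iffD1, rotated])
      (use coordinate_in_subsimplex t in \<open>auto simp: space_pair_measure space_restrict_space\<close>)
qed

lemma integrable_coordinate:
  assumes F: "continuous_state_fun T F" and s: "s \<in> {t..T}"
  shows "integrable (Pr t z) (\<lambda>\<omega>. F s (fst (Z s \<omega>)) (snd (Z s \<omega>)))"
proof -
  interpret prob_space "Pr t z" by (rule prob_space_law)
  obtain B where B: "\<And>t d x. t \<in> {0..T} \<Longrightarrow> x \<in> subsimplex \<Longrightarrow> \<bar>F t d x\<bar> \<le> B"
    using continuous_state_fun_bounded[OF F] by blast
  show ?thesis
  proof (rule integrable_const_bound[of _ B])
    show "AE \<omega> in Pr t z. norm (F s (fst (Z s \<omega>)) (snd (Z s \<omega>))) \<le> B"
      using B coordinate_in_subsimplex s t by (intro AE_I2) auto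
    have "s \<in> {0..T}" using s t by auto
    from measurable_compose[OF coordinate_measurable[OF s]
        continuous_state_fun_slice_measurable[OF F this]]
    show "(\<lambda>\<omega>. F s (fst (Z s \<omega>)) (snd (Z s \<omega>))) \<in> borel_measurable (Pr t z)" .
  qed
qed

lemma mean_bounded:
  assumes F: "continuous_state_fun T F" and s: "s \<in> {t..T}"
    and B: "\<And>d x. x \<in> subsimplex \<Longrightarrow> \<bar>F s d x\<bar> \<le> B"
  shows "\<bar>mean F t z s\<bar> \<le> B"
proof -
  interpret prob_space "Pr t z" by (rule prob_space_law)
  have "\<bar>mean F t z s\<bar> \<le> (\<integral>\<omega>. \<bar>F s (fst (Z s \<omega>)) (snd (Z s \<omega>))\<bar> \<partial>Pr t z)"
    unfolding mean_def by (rule integral_abs_bound)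
  also have "\<dots> \<le> B"
    using B coordinate_in_subsimplex[OF s]
    by (intro integral_le_const integrable_abs integrable_coordinate AE_I2 F s) auto
  finally show ?thesis .
qed

lemma mean_start:
  assumes F: "continuous_state_fun T F"
  shows "mean F t z t = F t (fst z) (snd z)"
proof -
  interpret prob_space "Pr t z" by (rule prob_space_law)
  have "AE \<omega> in Pr t z. F t (fst (Z t \<omega>)) (snd (Z t \<omega>)) = F t (fst z) (snd z)"
    using start by eventually_elim simp
  then have "mean F t z t = (\<integral>\<omega>. F t (fst z) (snd z) \<partial>Pr t z)"
    using integrable_coordinate[OF F, of t] t unfolding mean_def
    by (intro integral_cong_AE) auto
  then show ?thesis by (simp add: prob_space)
qed

lemma subalgebra_past:
  assumes s: "s \<in> {t..T}" shows "subalgebra (Pr t z) (past (Pr t z) Z t s)"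
proof -
  let ?E = "{Z r -` B \<inter> space (Pr t z) | r B. r \<in> {t..s} \<and> B \<in> sets state_algebra}"
  have "?E \<subseteq> sets (Pr t z)"
    using measurable_sets[OF coordinate_measurable] s by auto
  then have "sigma_sets (space (Pr t z)) ?E \<subseteq> sets (Pr t z)"
    by (rule sets.sigma_sets_subset)
  moreover have "?E \<subseteq> Pow (space (Pr t z))" by auto
  ultimately show ?thesis
    unfolding subalgebra_def past_def by (simp add: space_measure_of sets_measure_of)
qed

text \<open>
  The Markov property in integrated form (Chapman-Kolmogorov): taking expectations in the conditional
  expectation given the past up to time \<open>s\<close>.
\<close>

lemma mean_measurable_tower:
  assumes F: "continuous_state_fun T F" and s: "s \<in> {t..T}" and u: "u \<in> {s..T}"
  shows "(\<lambda>y. mean F s y u) \<in> borel_measurable state_algebra"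
    and "mean F t z u = (\<integral>\<omega>. mean F s (Z s \<omega>) u \<partial>Pr t z)"
proof -
  interpret prob_space "Pr t z" by (rule prob_space_law)
  interpret finite_measure_subalgebra "Pr t z" "past (Pr t z) Z t s"
    by unfold_locales (rule subalgebra_past[OF s])
  let ?h = "\<lambda>y. F u (fst y) (snd y)"
  have u': "u \<in> {0..T}" "u \<in> {t..T}" using s u t by auto
  obtain B where B: "\<And>t d x. t \<in> {0..T} \<Longrightarrow> x \<in> subsimplex \<Longrightarrow> \<bar>F t d x\<bar> \<le> B"
    using continuous_state_fun_bounded[OF F] by blast
  have "bounded (?h ` (UNIV \<times> subsimplex))"
    using B u' by (intro boundedI[of _ B]) auto
  moreover have "?h \<in> borel_measurable state_algebra"
    by (rule continuous_state_fun_slice_measurable[OF F u'(1)])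
  moreover have "0 \<le> s" "s \<le> u" "u \<le> T" "t \<in> {0..s}" using s u t by auto
  ultimately have h: "(\<lambda>y. \<integral>\<omega>. ?h (Z u \<omega>) \<partial>Pr s y) \<in> borel_measurable state_algebra"
    and ce: "AE \<omega> in Pr t z. real_cond_exp (Pr t z) (past (Pr t z) Z t s) (\<lambda>\<omega>'. ?h (Z u \<omega>')) \<omega>
             = (\<integral>\<omega>'. ?h (Z u \<omega>') \<partial>Pr s (Z s \<omega>))"
    using markov z unfolding markov_process_def by blast+
  show meas: "(\<lambda>y. mean F s y u) \<in> borel_measurable state_algebra"
    using h by (simp add: mean_def)
  have "mean F t z u = (\<integral>\<omega>. real_cond_exp (Pr t z) (past (Pr t z) Z t s) (\<lambda>\<omega>'. ?h (Z u \<omega>')) \<omega> \<partial>Pr t z)"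
    unfolding mean_def by (rule real_cond_exp_int(2)[symmetric]) (rule integrable_coordinate[OF F u'(2)])
  also have "\<dots> = (\<integral>\<omega>. mean F s (Z s \<omega>) u \<partial>Pr t z)"
  proof (rule integral_cong_AE)
    show "(\<lambda>\<omega>. mean F s (Z s \<omega>) u) \<in> borel_measurable (Pr t z)"
      by (rule measurable_compose[OF coordinate_measurable[OF s] meas])
  qed (use ce in \<open>auto simp: mean_def\<close>)
  finally show "mean F t z u = (\<integral>\<omega>. mean F s (Z s \<omega>) u \<partial>Pr t z)" .
qed

lemma Fubini_path:
  assumes F: "continuous_state_fun T F"
  shows "integrable (Pr t z) (\<lambda>\<omega>. LINT s:{t..T}|lborel. F s (fst (Z s \<omega>)) (snd (Z s \<omega>)))"
    and "set_integrable lborel {t..T} (mean F t z)"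
    and "(\<integral>\<omega>. (LINT s:{t..T}|lborel. F s (fst (Z s \<omega>)) (snd (Z s \<omega>))) \<partial>Pr t z)
           = (LINT s:{t..T}|lborel. mean F t z s)"
proof -
  interpret P: prob_space "Pr t z" by (rule prob_space_law)
  let ?I = "restrict_space lborel {t..T}"
  have "finite_measure ?I"
    by (intro finite_measureI) (simp add: emeasure_restrict_space space_restrict_space emeasure_lborel_Icc_eq)
  then interpret I: finite_measure ?I .
  interpret pair_sigma_finite ?I "Pr t z" ..
  interpret IP: finite_measure "?I \<Otimes>\<^sub>M Pr t z"
    by (rule finite_measure_pair_measure) unfold_locales
  obtain B where B: "\<And>t d x. t \<in> {0..T} \<Longrightarrow> x \<in> subsimplex \<Longrightarrow> \<bar>F t d x\<bar> \<le> B"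
    using continuous_state_fun_bounded[OF F] by blast
  have "sets (?I \<Otimes>\<^sub>M Pr t z) = sets (restrict_space borel {t..T} \<Otimes>\<^sub>M Pr t z)"
    by (intro sets_pair_measure_cong sets_restrict_space_cong) simp_all
  then have "(\<lambda>(s, \<omega>). F s (fst (Z s \<omega>)) (snd (Z s \<omega>))) \<in> borel_measurable (?I \<Otimes>\<^sub>M Pr t z)"
    using path_measurable[OF F] by (simp cong: measurable_cong_sets)
  then have int: "integrable (?I \<Otimes>\<^sub>M Pr t z) (\<lambda>(s, \<omega>). F s (fst (Z s \<omega>)) (snd (Z s \<omega>)))"
    using B coordinate_in_subsimplex t
    by (intro IP.integrable_const_bound[of _ B] AE_I2)
      (auto simp: space_pair_measure space_restrict_space)
  have restr: "integral\<^sup>L ?I h = (LINT s:{t..T}|lborel. h s)" for h :: "real \<Rightarrow> real"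
    unfolding set_lebesgue_integral_def by (subst integral_restrict_space) auto
  show "integrable (Pr t z) (\<lambda>\<omega>. LINT s:{t..T}|lborel. F s (fst (Z s \<omega>)) (snd (Z s \<omega>)))"
    using integrable_snd[OF int] by (simp add: restr)
  show "set_integrable lborel {t..T} (mean F t z)"
    using integrable_fst[OF int] unfolding set_integrable_def mean_def
    by (subst (asm) integrable_restrict_space) auto
  show "(\<integral>\<omega>. (LINT s:{t..T}|lborel. F s (fst (Z s \<omega>)) (snd (Z s \<omega>))) \<partial>Pr t z)
           = (LINT s:{t..T}|lborel. mean F t z s)"
    using Fubini_integral[OF int] by (simp add: restr mean_def)
qed

end

text \<open>
  Let \<open>u s = E F(s, Z s)\<close> and \<open>w s = E (G F)(s, Z s)\<close> under the law started in \<open>z\<close> at time \<open>t\<close>. By the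
  Markov property the increment \<open>u (s + h) - u s\<close> is the mean of the increments of \<open>F\<close> over \<open>[s, s + h]\<close>
  when the process restarts at time \<open>s\<close> from the random state \<open>Z s\<close>. The generator describes those
  uniformly in the state, so the estimate survives averaging: the right difference quotients of \<open>u\<close>
  converge to \<open>w\<close> uniformly, and \<open>w\<close> integrates to the increment of \<open>u\<close>.
\<close>

lemma Dynkin_formula:
  assumes gen: "has_space_time_generator T Pr Z G"
    and C1: "C1 T F" and GF: "continuous_state_fun T (G F)"
    and t: "t \<in> {0..T}" and z: "z \<in> UNIV \<times> subsimplex"
  shows "mean F t z T = F t (fst z) (snd z) + (LINT s:{t..T}|lborel. mean (G F) t z s)"
proof -
  interpret P: prob_space "Pr t z" by (rule prob_space_law[OF t z])
  note F = C1_continuous(1)[OF C1]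
  obtain B where B: "\<And>t d x. t \<in> {0..T} \<Longrightarrow> x \<in> subsimplex \<Longrightarrow> \<bar>G F t d x\<bar> \<le> B"
    using continuous_state_fun_bounded[OF GF] by blast
  obtain C where C: "\<And>t d x. t \<in> {0..T} \<Longrightarrow> x \<in> subsimplex \<Longrightarrow> \<bar>F t d x\<bar> \<le> C"
    using continuous_state_fun_bounded[OF F] by blast
  have "(mean (G F) t z has_integral mean F t z T - mean F t z t) {t..T}"
  proof (rule has_integral_uniform_right_derivative)
    show "\<bar>mean (G F) t z s\<bar> \<le> B" if "s \<in> {t..T}" for s
      using that B t by (intro mean_bounded[OF t z GF]) auto
    fix e :: real assume "0 < e"
    have "\<exists>\<delta>>0. \<forall>h t d x. 0 < h \<and> h < \<delta> \<and> 0 \<le> t \<and> t + h \<le> T \<and> x \<in> subsimplex \<longrightarrow>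
        \<bar>(mean F t (d, x) (t + h) - F t d x) / h - G F t d x\<bar> < e"
      unfolding mean_def
      by (rule gen[unfolded has_space_time_generator_def, THEN spec, THEN mp, OF C1,
          THEN spec, THEN mp, OF \<open>0 < e\<close>])
    then obtain \<delta> where "0 < \<delta>"
      and gen_\<delta>: "\<forall>h t d x. 0 < h \<and> h < \<delta> \<and> 0 \<le> t \<and> t + h \<le> T \<and> x \<in> subsimplex \<longrightarrow>
        \<bar>(mean F t (d, x) (t + h) - F t d x) / h - G F t d x\<bar> < e"
      by (elim exE conjE) (rule that)
    have \<delta>: "\<bar>(mean F t (d, x) (t + h) - F t d x) / h - G F t d x\<bar> < e"
      if "0 < h" "h < \<delta>" "0 \<le> t" "t + h \<le> T" "x \<in> subsimplex" for h t d x
      using gen_\<delta> that by simp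
    show "\<exists>\<delta>>0. \<forall>h s. 0 < h \<and> h < \<delta> \<and> t \<le> s \<and> s + h \<le> T \<longrightarrow>
        \<bar>(mean F t z (s + h) - mean F t z s) / h - mean (G F) t z s\<bar> \<le> e"
    proof (intro exI[of _ \<delta>] conjI allI impI \<open>0 < \<delta>\<close>)
      fix h s assume "0 < h \<and> h < \<delta> \<and> t \<le> s \<and> s + h \<le> T"
      then have h: "0 < h" "h < \<delta>" and s: "s \<in> {t..T}" "s \<in> {0..T}" and sh: "s + h \<in> {s..T}"
        and sh': "s + h \<in> {t..T}" using t by auto
      let ?a = "\<lambda>\<omega>. mean F s (Z s \<omega>) (s + h)"
        and ?b = "\<lambda>\<omega>. F s (fst (Z s \<omega>)) (snd (Z s \<omega>))"
        and ?c = "\<lambda>\<omega>. G F s (fst (Z s \<omega>)) (snd (Z s \<omega>))"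
      have Zs: "Z s \<omega> \<in> UNIV \<times> subsimplex" if "\<omega> \<in> space (Pr t z)" for \<omega>
        using coordinate_in_subsimplex[OF t z s(1) that] by (simp add: mem_Times_iff)
      have int_a: "integrable (Pr t z) ?a"
      proof (rule P.integrable_const_bound[of _ C])
        show "AE \<omega> in Pr t z. norm (?a \<omega>) \<le> C"
        proof (rule AE_I2)
          fix \<omega> assume "\<omega> \<in> space (Pr t z)"
          from mean_bounded[OF s(2) Zs[OF this] F sh] show "norm (?a \<omega>) \<le> C"
            using C sh s by simp
        qed
        show "?a \<in> borel_measurable (Pr t z)"
          by (rule measurable_compose[OF coordinate_measurable[OF t z s(1)]
                mean_measurable_tower(1)[OF t z F s(1) sh]])
      qed
      have int_b: "integrable (Pr t z) ?b" and int_c: "integrable (Pr t z) ?c"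
        by (rule integrable_coordinate[OF t z _ s(1)], rule F GF)+
      have "(mean F t z (s + h) - mean F t z s) / h - mean (G F) t z s
          = (\<integral>\<omega>. (?a \<omega> - ?b \<omega>) / h - ?c \<omega> \<partial>Pr t z)"
        using int_a int_b int_c
        by (simp add: mean_measurable_tower(2)[OF t z F s(1) sh] mean_def[of F t z s]
            mean_def[of "G F"])
      moreover have "norm (\<integral>\<omega>. (?a \<omega> - ?b \<omega>) / h - ?c \<omega> \<partial>Pr t z) \<le> e"
      proof -
        have le: "\<bar>(?a \<omega> - ?b \<omega>) / h - ?c \<omega>\<bar> \<le> e" if "\<omega> \<in> space (Pr t z)" for \<omega>
          using \<delta>[of h s "snd (Z s \<omega>)" "fst (Z s \<omega>)"] h s sh
            coordinate_in_subsimplex[OF t z s(1) that]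
          by (simp add: less_imp_le)
        have "norm (\<integral>\<omega>. (?a \<omega> - ?b \<omega>) / h - ?c \<omega> \<partial>Pr t z)
            \<le> (\<integral>\<omega>. norm ((?a \<omega> - ?b \<omega>) / h - ?c \<omega>) \<partial>Pr t z)"
          by (rule integral_norm_bound)
        also have "\<dots> \<le> e"
        proof (rule P.integral_le_const)
          show "integrable (Pr t z) (\<lambda>\<omega>. norm ((?a \<omega> - ?b \<omega>) / h - ?c \<omega>))"
            using int_a int_b int_c
            by (intro integrable_norm Bochner_Integration.integrable_diff integrable_divide_zero) auto
        qed (use le in \<open>auto intro!: AE_I2\<close>)
        finally show ?thesis .
      qed
      ultimately show "\<bar>(mean F t z (s + h) - mean F t z s) / h - mean (G F) t z s\<bar> \<le> e"
        by simp
    qed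
  qed (use t in auto)
  moreover have "(LINT s:{t..T}|lborel. mean (G F) t z s) = integral {t..T} (mean (G F) t z)"
    by (rule set_borel_integral_eq_integral(2)[OF Fubini_path(2)[OF t z GF]])
  ultimately show ?thesis
    by (simp add: integral_unique mean_start[OF t z F])
qed

text \<open>
  A cost with terminal part \<open>F T\<close> differs from \<open>F\<close> by the mean defect in the equation \<open>G F + c = 0\<close>,
  accumulated along the paths.
\<close>

lemma cost_representation:
  assumes gen: "has_space_time_generator T Pr Z G"
    and C1: "C1 T F" and GF: "continuous_state_fun T (G F)"
    and c: "continuous_state_fun T c"
    and t: "t \<in> {0..T}" and z: "z \<in> UNIV \<times> subsimplex"
  shows "(\<integral>\<omega>. (LINT s:{t..T}|lborel. c s (fst (Z s \<omega>)) (snd (Z s \<omega>)))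
              + F T (fst (Z T \<omega>)) (snd (Z T \<omega>)) \<partial>Pr t z)
     = F t (fst z) (snd z) + (LINT s:{t..T}|lborel. mean (\<lambda>s d x. G F s d x + c s d x) t z s)"
proof -
  note F = C1_continuous(1)[OF C1]
  have T: "T \<in> {t..T}" using t by auto
  have "(\<integral>\<omega>. (LINT s:{t..T}|lborel. c s (fst (Z s \<omega>)) (snd (Z s \<omega>)))
              + F T (fst (Z T \<omega>)) (snd (Z T \<omega>)) \<partial>Pr t z)
      = (LINT s:{t..T}|lborel. mean c t z s) + mean F t z T"
    unfolding mean_def[of F t z T] Fubini_path(3)[OF t z c, symmetric]
    by (rule Bochner_Integration.integral_add[OF Fubini_path(1)[OF t z c]
        integrable_coordinate[OF t z F T]])
  also have "\<dots> = F t (fst z) (snd z)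
      + ((LINT s:{t..T}|lborel. mean (G F) t z s) + (LINT s:{t..T}|lborel. mean c t z s))"
    using Dynkin_formula[where F = F and G = G, OF gen C1 GF t z] by simp
  also have "(LINT s:{t..T}|lborel. mean (G F) t z s) + (LINT s:{t..T}|lborel. mean c t z s)
      = (LINT s:{t..T}|lborel. mean (G F) t z s + mean c t z s)"
    by (rule set_integral_add(2)[OF Fubini_path(2)[OF t z GF] Fubini_path(2)[OF t z c], symmetric])
  also have "\<dots> = (LINT s:{t..T}|lborel. mean (\<lambda>s d x. G F s d x + c s d x) t z s)"
  proof (rule set_lebesgue_integral_cong)
    show "\<forall>s. s \<in> {t..T} \<longrightarrow>
        mean (G F) t z s + mean c t z s = mean (\<lambda>s d x. G F s d x + c s d x) t z s"
    proof (intro allI impI)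
      fix s assume s: "s \<in> {t..T}"
      show "mean (G F) t z s + mean c t z s = mean (\<lambda>s d x. G F s d x + c s d x) t z s"
        unfolding mean_def
        by (rule Bochner_Integration.integral_add[OF integrable_coordinate[OF t z GF s]
              integrable_coordinate[OF t z c s], symmetric])
    qed
  qed simp
  finally show ?thesis .
qed

lemma verification:
  assumes gen: "has_space_time_generator T Pr Z G"
    and C1: "C1 T F" and GF: "continuous_state_fun T (G F)"
    and c: "continuous_state_fun T c"
    and t: "t \<in> {0..T}" and z: "z \<in> UNIV \<times> subsimplex"
    and le: "\<And>s d x. \<lbrakk>s \<in> {0..T}; x \<in> subsimplex\<rbrakk> \<Longrightarrow> 0 \<le> G F s d x + c s d x"
  shows "F t (fst z) (snd z)
     \<le> (\<integral>\<omega>. (LINT s:{t..T}|lborel. c s (fst (Z s \<omega>)) (snd (Z s \<omega>)))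
              + F T (fst (Z T \<omega>)) (snd (Z T \<omega>)) \<partial>Pr t z)"
proof -
  have "0 \<le> mean (\<lambda>s d x. G F s d x + c s d x) t z s" if "s \<in> {t..T}" for s
    unfolding mean_def
    using le t that coordinate_in_subsimplex[OF t z that]
    by (intro Bochner_Integration.integral_nonneg_AE AE_I2) auto
  then have "0 \<le> (LINT s:{t..T}|lborel. mean (\<lambda>s d x. G F s d x + c s d x) t z s)"
    unfolding set_lebesgue_integral_def
    by (intro Bochner_Integration.integral_nonneg) (simp add: indicator_def)
  then show ?thesis
    using cost_representation[where F = F and G = G, OF gen C1 GF c t z] by linarith
qed

lemma verification_eq:
  assumes gen: "has_space_time_generator T Pr Z G"
    and C1: "C1 T F" and GF: "continuous_state_fun T (G F)"
    and c: "continuous_state_fun T c"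
    and t: "t \<in> {0..T}" and z: "z \<in> UNIV \<times> subsimplex"
    and eq: "\<And>s d x. \<lbrakk>s \<in> {0..T}; x \<in> subsimplex\<rbrakk> \<Longrightarrow> G F s d x + c s d x = 0"
  shows "(\<integral>\<omega>. (LINT s:{t..T}|lborel. c s (fst (Z s \<omega>)) (snd (Z s \<omega>)))
              + F T (fst (Z T \<omega>)) (snd (Z T \<omega>)) \<partial>Pr t z) = F t (fst z) (snd z)"
proof -
  have "mean (\<lambda>s d x. G F s d x + c s d x) t z s = 0" if "s \<in> {t..T}" for s
  proof -
    have "mean (\<lambda>s d x. G F s d x + c s d x) t z s = (\<integral>\<omega>. 0 \<partial>Pr t z)"
      unfolding mean_def
      using eq t that coordinate_in_subsimplex[OF t z that]
      by (intro Bochner_Integration.integral_cong refl) auto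
    then show ?thesis by simp
  qed
  then have "(LINT s:{t..T}|lborel. mean (\<lambda>s d x. G F s d x + c s d x) t z s)
      = (LINT s:{t..T}|lborel. 0)"
    by (intro set_lebesgue_integral_cong) auto
  then show ?thesis
    using cost_representation[where F = F and G = G, OF gen C1 GF c t z]
    by (simp add: set_lebesgue_integral_def)
qed

end

section \<open>Lipschitz continuity of feedbacks\<close>

text \<open>
  On the compact convex set \<open>[0,T] \<times> subsimplex\<close> the partial derivatives are bounded, and the mean value
  inequality applies. Admissibility of the candidate feedbacks rests on this.
\<close>

lemma C1_imp_lipschitz:
  fixes F :: "real \<Rightarrow> 'd::finite \<Rightarrow> real ^ 'm::finite \<Rightarrow> real"
  assumes C1: "C1 T F"
  shows "\<exists>L. \<forall>d. L-lipschitz_on ({0..T} \<times> subsimplex) (\<lambda>(t, x). F t d x)"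
proof -
  let ?K = "{0..T} \<times> (subsimplex :: (real ^ 'm) set)"
  obtain B where B: "\<And>t d x. t \<in> {0..T} \<Longrightarrow> x \<in> subsimplex \<Longrightarrow> \<bar>partial_t T F t d x\<bar> \<le> B"
    using continuous_state_fun_bounded[OF C1_continuous(2)[OF C1]] by blast
  have "\<forall>l. \<exists>C. \<forall>t d x. t \<in> {0..T} \<longrightarrow> x \<in> subsimplex \<longrightarrow> \<bar>partial_x T F l t d x\<bar> \<le> C"
    using continuous_state_fun_bounded[OF C1_continuous(3)[OF C1]] by metis
  then obtain C where C: "\<And>l t d x. t \<in> {0..T} \<Longrightarrow> x \<in> subsimplex \<Longrightarrow> \<bar>partial_x T F l t d x\<bar> \<le> C l"
    by metis
  let ?L = "\<bar>B\<bar> + (\<Sum>l\<in>UNIV. \<bar>C l\<bar>)"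
  have "?L-lipschitz_on ?K (\<lambda>(t, x). F t d x)" for d
  proof (rule bounded_derivative_imp_lipschitz)
    show "convex ?K" by (intro convex_Times convex_subsimplex) simp
    show "0 \<le> ?L" by (simp add: sum_nonneg)
    fix p assume p: "p \<in> ?K"
    let ?D = "frechet_derivative (\<lambda>(t, x). F t d x) (at p within ?K)"
    have diff: "(\<lambda>(t, x). F t d x) differentiable at p within ?K"
      using C1 p by (auto simp: C1_def differentiable_on_def)
    then show "((\<lambda>(t, x). F t d x) has_derivative ?D) (at p within ?K)"
      by (simp add: frechet_derivative_works)
    interpret D: linear ?D by (rule linear_frechet_derivative[OF diff])
    show "onorm ?D \<le> ?L"
    proof (rule onorm_bound)
      fix v :: "real \<times> (real ^ 'm)"
      obtain a y where v: "v = (a, y)" by (cases v)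
      have "v = a *\<^sub>R (1, 0) + (\<Sum>l\<in>UNIV. y $ l *\<^sub>R (0, axis l 1))"
        using basis_expansion[of y]
        by (simp add: v prod_eq_iff fst_sum snd_sum scalar_mult_eq_scaleR)
      then have "?D v = a * ?D (1, 0) + (\<Sum>l\<in>UNIV. y $ l * ?D (0, axis l 1))"
        by (simp add: D.add D.sum D.scale del: scaleR_Pair)
      also have "\<bar>\<dots>\<bar> \<le> \<bar>a * ?D (1, 0)\<bar> + (\<Sum>l\<in>UNIV. \<bar>y $ l * ?D (0, axis l 1)\<bar>)"
        by (intro order_trans[OF abs_triangle_ineq] add_left_mono sum_abs)
      also have "\<dots> \<le> \<bar>B\<bar> * norm v + (\<Sum>l\<in>UNIV. \<bar>C l\<bar> * norm v)"
      proof (intro add_mono sum_mono)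
        have "\<bar>a\<bar> \<le> norm v" using norm_fst_le[of a y] by (simp add: v)
        moreover have "\<bar>?D (1, 0)\<bar> \<le> \<bar>B\<bar>"
          using B[of "fst p" "snd p" d] p by (auto simp: partial_t_def)
        ultimately show "\<bar>a * ?D (1, 0)\<bar> \<le> \<bar>B\<bar> * norm v"
          unfolding abs_mult by (subst mult.commute) (intro mult_mono; simp)
        fix l
        have "\<bar>y $ l\<bar> \<le> norm v"
          using component_le_norm_cart[of y l] norm_snd_le[of y a] by (simp add: v)
        moreover have "\<bar>?D (0, axis l 1)\<bar> \<le> \<bar>C l\<bar>"
          using C[of "fst p" "snd p" l d] p by (auto simp: partial_x_def)
        ultimately show "\<bar>y $ l * ?D (0, axis l 1)\<bar> \<le> \<bar>C l\<bar> * norm v"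
          unfolding abs_mult by (subst mult.commute) (intro mult_mono; simp)
      qed
      finally show "norm (?D v) \<le> ?L * norm v"
        by (simp add: distrib_right sum_distrib_right)
    qed (simp add: sum_nonneg)
  qed
  then show ?thesis by blast
qed

lemma lipschitz_on_vec_lambda:
  fixes h :: "'n::finite \<Rightarrow> 'p::metric_space \<Rightarrow> 'c::real_normed_vector"
  assumes "\<And>j. L-lipschitz_on S (h j)"
  shows "(real CARD('n) * L)-lipschitz_on S (\<lambda>p. \<chi> j. h j p)"
proof (rule lipschitz_onI)
  show "0 \<le> real CARD('n) * L" using lipschitz_on_nonneg[OF assms] by simp
  fix p p' assume p: "p \<in> S" "p' \<in> S"
  have "dist (\<chi> j. h j p) (\<chi> j. h j p') \<le> (\<Sum>j\<in>UNIV. dist (h j p) (h j p'))"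
    unfolding dist_vec_def by (rule order_trans[OF L2_set_le_sum]) auto
  also have "\<dots> \<le> (\<Sum>j\<in>(UNIV :: 'n set). L * dist p p')"
    by (intro sum_mono lipschitz_onD[OF assms] p)
  finally show "dist (\<chi> j. h j p) (\<chi> j. h j p') \<le> real CARD('n) * L * dist p p'" by simp
qed

text \<open>
  Applied with the minimizer of the Hamiltonian for \<open>a\<close> and a value function for \<open>h\<close>, this makes the
  equilibrium feedbacks Lipschitz.
\<close>

lemma lipschitz_on_feedback:
  fixes a :: "real \<times> (real ^ 'm::finite) \<times> 'v::metric_space \<Rightarrow> 'c::metric_space"
  assumes a: "K-lipschitz_on ({0..T} \<times> subsimplex \<times> UNIV) a"
    and h: "M-lipschitz_on ({0..T} \<times> subsimplex) h"
    and eq: "\<And>t x. \<lbrakk>t \<in> {0..T}; x \<in> subsimplex\<rbrakk> \<Longrightarrow> \<psi> t x = a (t, x, h (t, x))"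
  shows "(K * sqrt (1\<^sup>2 + (sqrt (1\<^sup>2 + M\<^sup>2))\<^sup>2))-lipschitz_on ({0..T} \<times> subsimplex) (\<lambda>(t, x). \<psi> t x)"
proof -
  have "1-lipschitz_on ({0..T} \<times> subsimplex) (fst :: real \<times> (real ^ 'm) \<Rightarrow> real)"
    "1-lipschitz_on ({0..T} \<times> subsimplex) (snd :: real \<times> (real ^ 'm) \<Rightarrow> real ^ 'm)"
    by (intro lipschitz_onI; simp only: mult_1 dist_fst_le dist_snd_le zero_le_one)+
  note inner = lipschitz_on_Pair[OF this(1) lipschitz_on_Pair[OF this(2) h]]
  have "(K * sqrt (1\<^sup>2 + (sqrt (1\<^sup>2 + M\<^sup>2))\<^sup>2))-lipschitz_on ({0..T} \<times> subsimplex)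
      (\<lambda>p. a (fst p, snd p, h p))"
    by (rule lipschitz_on_compose2[OF inner]) (auto intro: lipschitz_on_subset[OF a])
  then show ?thesis
    by (rule lipschitz_on_transform) (use eq in auto)
qed

section \<open>Generators and costs along Lipschitz feedbacks\<close>

lemma continuous_on_feedback:
  assumes h: "L-lipschitz_on ({0..T} \<times> C \<times> subsimplex) (\<lambda>(t, \<alpha>, x). h t \<alpha> x)"
    and \<psi>: "K-lipschitz_on ({0..T} \<times> subsimplex) (\<lambda>(t, x). \<psi> t x)"
    and range: "\<forall>t\<in>{0..T}. \<forall>x\<in>subsimplex. \<psi> t x \<in> C"
  shows "continuous_on ({0..T} \<times> subsimplex) (\<lambda>p. h (fst p) (\<psi> (fst p) (snd p)) (snd p))"
proof -
  have "continuous_on ({0..T} \<times> subsimplex) (\<lambda>p. (fst p, \<psi> (fst p) (snd p), snd p))"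
    using lipschitz_on_continuous_on[OF \<psi>] by (auto intro!: continuous_intros simp: case_prod_beta)
  moreover have "(\<lambda>p. (fst p, \<psi> (fst p) (snd p), snd p)) ` ({0..T} \<times> subsimplex)
      \<subseteq> {0..T} \<times> C \<times> subsimplex"
    using range by auto
  ultimately have "continuous_on ({0..T} \<times> subsimplex)
      (\<lambda>p. (\<lambda>(t, \<alpha>, x). h t \<alpha> x) (fst p, \<psi> (fst p) (snd p), snd p))"
    by (rule continuous_on_compose2[OF lipschitz_on_continuous_on[OF h]])
  then show ?thesis by simp
qed

lemma admissible0_continuous:
  assumes h: "L-lipschitz_on ({0..T} \<times> A0 \<times> subsimplex) (\<lambda>(t, \<alpha>, x). h t \<alpha> x)"
    and \<psi>0: "\<psi>0 \<in> admissible0 T A0"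
  shows "continuous_on ({0..T} \<times> subsimplex) (\<lambda>p. h (fst p) (\<psi>0 (fst p) i0 (snd p)) (snd p))"
proof -
  obtain K where "K-lipschitz_on ({0..T} \<times> subsimplex) (\<lambda>(t, x). \<psi>0 t i0 x)"
    using \<psi>0 unfolding admissible0_def by blast
  from continuous_on_feedback[OF h this] show ?thesis
    using \<psi>0 by (simp add: admissible0_def)
qed

lemma admissible_continuous:
  assumes h: "L-lipschitz_on ({0..T} \<times> A \<times> subsimplex) (\<lambda>(t, \<alpha>, x). h t \<alpha> x)"
    and \<psi>: "\<psi> \<in> admissible T A"
  shows "continuous_on ({0..T} \<times> subsimplex) (\<lambda>p. h (fst p) (\<psi> (fst p) i i0 (snd p)) (snd p))"
proof -
  obtain K where "K-lipschitz_on ({0..T} \<times> subsimplex) (\<lambda>(t, x). \<psi> t i i0 x)"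
    using \<psi> unfolding admissible_def by blast
  from continuous_on_feedback[OF h this] show ?thesis
    using \<psi> by (simp add: admissible_def)
qed

context mfg_data
begin

lemma q_continuous:
  assumes "\<psi> \<in> admissible T A"
  shows "continuous_on ({0..T} \<times> subsimplex)
    (\<lambda>p. q (fst p) i j (\<psi> (fst p) i i0 (snd p)) i0 (snd p))"
proof -
  obtain L where "L-lipschitz_on ({0..T} \<times> A \<times> subsimplex) (\<lambda>(t, \<alpha>, x). q t i j \<alpha> i0 x)"
    using lipschitz by blast
  from admissible_continuous[OF this assms] show ?thesis .
qed

lemma q0_continuous:
  assumes "\<psi>0 \<in> admissible0 T A0"
  shows "continuous_on ({0..T} \<times> subsimplex)
    (\<lambda>p. q0 (fst p) i0 j0 (\<psi>0 (fst p) i0 (snd p)) (snd p))"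
proof -
  obtain L where "L-lipschitz_on ({0..T} \<times> A0 \<times> subsimplex) (\<lambda>(t, \<alpha>0, x). q0 t i0 j0 \<alpha>0 x)"
    using lipschitz by blast
  from admissible0_continuous[OF this assms] show ?thesis .
qed

lemma f0_continuous:
  assumes "\<psi>0 \<in> admissible0 T A0"
  shows "continuous_state_fun T (\<lambda>t i0 x. f0 t i0 (\<psi>0 t i0 x) x)"
  unfolding continuous_state_fun_def case_prod_beta
proof
  fix i0
  obtain L where "L-lipschitz_on ({0..T} \<times> A0 \<times> subsimplex) (\<lambda>(t, \<alpha>0, x). f0 t i0 \<alpha>0 x)"
    using lipschitz by blast
  from admissible0_continuous[OF this assms]
  show "continuous_on ({0..T} \<times> subsimplex) (\<lambda>p. f0 (fst p) i0 (\<psi>0 (fst p) i0 (snd p)) (snd p))" .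
qed

lemma f_continuous:
  assumes "\<psi> \<in> admissible T A"
  shows "continuous_state_fun T (\<lambda>t d x. f t (fst d) (\<psi> t (fst d) (snd d) x) (snd d) x)"
  unfolding continuous_state_fun_def case_prod_beta
proof
  fix d :: "'m option \<times> 'k"
  obtain L where "L-lipschitz_on ({0..T} \<times> A \<times> subsimplex)
      (\<lambda>(t, \<alpha>, x). f t (fst d) \<alpha> (snd d) x)"
    using lipschitz by blast
  from admissible_continuous[OF this assms]
  show "continuous_on ({0..T} \<times> subsimplex)
      (\<lambda>p. f (fst p) (fst d) (\<psi> (fst p) (fst d) (snd d) (snd p)) (snd d) (snd p))" .
qed

lemma gen0_continuous:
  assumes "\<psi>0 \<in> admissible0 T A0" "\<psi> \<in> admissible T A" and C1: "C1 T F"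
  shows "continuous_state_fun T (gen0 T q0 q \<psi>0 \<psi> F)"
  unfolding continuous_state_fun_def gen0_def case_prod_beta
  by (intro allI continuous_intros C1_continuous[OF C1, THEN continuous_on_time_simplex]
      q_continuous q0_continuous assms)

lemma gen_continuous:
  assumes "\<psi>0 \<in> admissible0 T A0" "\<psi> \<in> admissible T A" "\<psi>b \<in> admissible T A" and C1: "C1 T F"
  shows "continuous_state_fun T (gen T q0 q \<psi>0 \<psi> \<psi>b F)"
proof -
  have "continuous_on ({0..T} \<times> subsimplex) (\<lambda>p. gen T q0 q \<psi>0 \<psi> \<psi>b F (fst p) (i, i0) (snd p))" for i i0
    unfolding gen.simps
    by (intro continuous_intros C1_continuous[OF C1, THEN continuous_on_time_simplex]
      q_continuous q0_continuous assms)
  then show ?thesis by (simp add: continuous_state_fun_def case_prod_beta)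
qed

text \<open>
  A subsolution of the linear backward equation of fixed feedbacks bounds their cost from below, a
  solution equals it. The signs of \<open>G V + c\<close> are assumed for the given feedbacks only, so that the first
  part applies to each deviation and the second to the equilibrium.
\<close>

lemma cost0_verification:
  fixes Pr0 :: "('m, 'k, 'a) feedback0 \<Rightarrow> ('m, 'k, 'b) feedback \<Rightarrow> real \<Rightarrow> 'k \<times> (real ^ 'm) \<Rightarrow> 'w measure"
  assumes adm: "\<psi>0 \<in> admissible0 T A0" "\<psi> \<in> admissible T A"
    and markov: "markov_process T (Pr0 \<psi>0 \<psi>) (Z0 \<psi>0 \<psi>)"
    and gen: "has_space_time_generator T (Pr0 \<psi>0 \<psi>) (Z0 \<psi>0 \<psi>) (gen0 T q0 q \<psi>0 \<psi>)"
    and C1: "C1 T V" and terminal: "\<And>i0 x. x \<in> subsimplex \<Longrightarrow> V T i0 x = g0 i0 x"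
    and t: "t \<in> {0..T}" and x: "x \<in> subsimplex"
  shows "(\<And>s j0 y. \<lbrakk>s \<in> {0..T}; y \<in> subsimplex\<rbrakk> \<Longrightarrow>
            0 \<le> gen0 T q0 q \<psi>0 \<psi> V s j0 y + f0 s j0 (\<psi>0 s j0 y) y)
          \<Longrightarrow> V t i0 x \<le> cost0 T f0 g0 Pr0 Z0 \<psi>0 \<psi> t i0 x"
    and "(\<And>s j0 y. \<lbrakk>s \<in> {0..T}; y \<in> subsimplex\<rbrakk> \<Longrightarrow>
            gen0 T q0 q \<psi>0 \<psi> V s j0 y + f0 s j0 (\<psi>0 s j0 y) y = 0)
          \<Longrightarrow> cost0 T f0 g0 Pr0 Z0 \<psi>0 \<psi> t i0 x = V t i0 x"
proof -
  interpret markov_family T "Pr0 \<psi>0 \<psi>" "Z0 \<psi>0 \<psi>" by unfold_locales (rule markov)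
  let ?Z = "Z0 \<psi>0 \<psi>" and ?c = "\<lambda>s j0 y. f0 s j0 (\<psi>0 s j0 y) y"
  have z: "(i0, x) \<in> UNIV \<times> subsimplex" using x by simp
  have T: "T \<in> {t..T}" using t by simp
  have cost: "cost0 T f0 g0 Pr0 Z0 \<psi>0 \<psi> t i0 x
    = (\<integral>\<omega>. (LINT s:{t..T}|lborel. ?c s (fst (?Z s \<omega>)) (snd (?Z s \<omega>)))
              + V T (fst (?Z T \<omega>)) (snd (?Z T \<omega>)) \<partial>Pr0 \<psi>0 \<psi> t (i0, x))"
    unfolding cost0_def case_prod_beta
    by (intro Bochner_Integration.integral_cong refl arg_cong2[where f = "(+)"]
        terminal[symmetric] coordinate_in_subsimplex[OF t z T])
  note regular = C1 gen0_continuous[OF adm C1] f0_continuous[OF adm(1)] t z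
  show "V t i0 x \<le> cost0 T f0 g0 Pr0 Z0 \<psi>0 \<psi> t i0 x"
    if "\<And>s j0 y. \<lbrakk>s \<in> {0..T}; y \<in> subsimplex\<rbrakk> \<Longrightarrow>
            0 \<le> gen0 T q0 q \<psi>0 \<psi> V s j0 y + f0 s j0 (\<psi>0 s j0 y) y"
    unfolding cost
    using verification[where F = V and G = "gen0 T q0 q \<psi>0 \<psi>" and c = ?c, OF gen regular that]
    by simp
  show "cost0 T f0 g0 Pr0 Z0 \<psi>0 \<psi> t i0 x = V t i0 x"
    if "\<And>s j0 y. \<lbrakk>s \<in> {0..T}; y \<in> subsimplex\<rbrakk> \<Longrightarrow>
            gen0 T q0 q \<psi>0 \<psi> V s j0 y + f0 s j0 (\<psi>0 s j0 y) y = 0"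
    unfolding cost
    using verification_eq[where F = V and G = "gen0 T q0 q \<psi>0 \<psi>" and c = ?c, OF gen regular that]
    by simp
qed

lemma cost_verification:
  fixes Pr :: "('m, 'k, 'a) feedback0 \<Rightarrow> ('m, 'k, 'b) feedback \<Rightarrow> ('m, 'k, 'b) feedback \<Rightarrow>
      real \<Rightarrow> ('m option \<times> 'k) \<times> (real ^ 'm) \<Rightarrow> 'w measure"
  assumes adm: "\<psi>0 \<in> admissible0 T A0" "\<psi> \<in> admissible T A" "\<psi>b \<in> admissible T A"
    and markov: "markov_process T (Pr \<psi>0 \<psi> \<psi>b) (Z \<psi>0 \<psi> \<psi>b)"
    and gen: "has_space_time_generator T (Pr \<psi>0 \<psi> \<psi>b) (Z \<psi>0 \<psi> \<psi>b) (gen T q0 q \<psi>0 \<psi> \<psi>b)"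
    and C1: "C1 T V" and terminal: "\<And>i i0 x. x \<in> subsimplex \<Longrightarrow> V T (i, i0) x = g i i0 x"
    and t: "t \<in> {0..T}" and x: "x \<in> subsimplex"
  shows "(\<And>s j j0 y. \<lbrakk>s \<in> {0..T}; y \<in> subsimplex\<rbrakk> \<Longrightarrow>
            0 \<le> gen T q0 q \<psi>0 \<psi> \<psi>b V s (j, j0) y + f s j (\<psi>b s j j0 y) j0 y)
          \<Longrightarrow> V t (i, i0) x \<le> cost T f g Pr Z \<psi>0 \<psi> \<psi>b t i i0 x"
    and "(\<And>s j j0 y. \<lbrakk>s \<in> {0..T}; y \<in> subsimplex\<rbrakk> \<Longrightarrow>
            gen T q0 q \<psi>0 \<psi> \<psi>b V s (j, j0) y + f s j (\<psi>b s j j0 y) j0 y = 0)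
          \<Longrightarrow> cost T f g Pr Z \<psi>0 \<psi> \<psi>b t i i0 x = V t (i, i0) x"
proof -
  interpret markov_family T "Pr \<psi>0 \<psi> \<psi>b" "Z \<psi>0 \<psi> \<psi>b" by unfold_locales (rule markov)
  let ?Z = "Z \<psi>0 \<psi> \<psi>b" and ?c = "\<lambda>s d y. f s (fst d) (\<psi>b s (fst d) (snd d) y) (snd d) y"
  have z: "((i, i0), x) \<in> UNIV \<times> subsimplex" using x by simp
  have T: "T \<in> {t..T}" using t by simp
  have terminal': "g (fst d) (snd d) y = V T d y" if "y \<in> subsimplex" for d y
    using terminal[OF that, of "fst d" "snd d"] by simp
  have cost: "cost T f g Pr Z \<psi>0 \<psi> \<psi>b t i i0 x
    = (\<integral>\<omega>. (LINT s:{t..T}|lborel. ?c s (fst (?Z s \<omega>)) (snd (?Z s \<omega>)))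
              + V T (fst (?Z T \<omega>)) (snd (?Z T \<omega>)) \<partial>Pr \<psi>0 \<psi> \<psi>b t ((i, i0), x))"
    unfolding cost_def case_prod_beta
    by (intro Bochner_Integration.integral_cong refl arg_cong2[where f = "(+)"]
        terminal' coordinate_in_subsimplex[OF t z T])
  note regular = C1 gen_continuous[OF adm C1] f_continuous[OF adm(3)] t z
  show "V t (i, i0) x \<le> cost T f g Pr Z \<psi>0 \<psi> \<psi>b t i i0 x"
    if "\<And>s j j0 y. \<lbrakk>s \<in> {0..T}; y \<in> subsimplex\<rbrakk> \<Longrightarrow>
            0 \<le> gen T q0 q \<psi>0 \<psi> \<psi>b V s (j, j0) y + f s j (\<psi>b s j j0 y) j0 y"
  proof -
    have "0 \<le> gen T q0 q \<psi>0 \<psi> \<psi>b V s d y + ?c s d y" if "s \<in> {0..T}" "y \<in> subsimplex" for s d y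
      using that \<open>\<And>s j j0 y. \<lbrakk>s \<in> {0..T}; y \<in> subsimplex\<rbrakk> \<Longrightarrow>
            0 \<le> gen T q0 q \<psi>0 \<psi> \<psi>b V s (j, j0) y + f s j (\<psi>b s j j0 y) j0 y\<close>[of s y "fst d" "snd d"]
      by simp
    from verification[where F = V and G = "gen T q0 q \<psi>0 \<psi> \<psi>b" and c = ?c, OF gen regular this]
    show ?thesis unfolding cost by simp
  qed
  show "cost T f g Pr Z \<psi>0 \<psi> \<psi>b t i i0 x = V t (i, i0) x"
    if "\<And>s j j0 y. \<lbrakk>s \<in> {0..T}; y \<in> subsimplex\<rbrakk> \<Longrightarrow>
            gen T q0 q \<psi>0 \<psi> \<psi>b V s (j, j0) y + f s j (\<psi>b s j j0 y) j0 y = 0"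
  proof -
    have "gen T q0 q \<psi>0 \<psi> \<psi>b V s d y + ?c s d y = 0" if "s \<in> {0..T}" "y \<in> subsimplex" for s d y
      using that \<open>\<And>s j j0 y. \<lbrakk>s \<in> {0..T}; y \<in> subsimplex\<rbrakk> \<Longrightarrow>
            gen T q0 q \<psi>0 \<psi> \<psi>b V s (j, j0) y + f s j (\<psi>b s j j0 y) j0 y = 0\<close>[of s y "fst d" "snd d"]
      by simp
    from verification_eq[where F = V and G = "gen T q0 q \<psi>0 \<psi> \<psi>b" and c = ?c, OF gen regular this]
    show ?thesis unfolding cost by simp
  qed
qed

end

section \<open>Minimizing the Hamiltonian\<close>

lemma is_arg_min_alpha_hat0:
  assumes "\<exists>!\<alpha>0. is_arg_min (hamiltonian0 q0 f0 t i0 x v0) (\<lambda>\<alpha>0. \<alpha>0 \<in> A0) \<alpha>0"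
    and "\<alpha> \<in> A0"
  shows "hamiltonian0 q0 f0 t i0 x v0 (alpha_hat0 A0 q0 f0 t i0 x v0) \<le> hamiltonian0 q0 f0 t i0 x v0 \<alpha>"
proof -
  have "is_arg_min (hamiltonian0 q0 f0 t i0 x v0) (\<lambda>\<alpha>0. \<alpha>0 \<in> A0) (alpha_hat0 A0 q0 f0 t i0 x v0)"
    using someI_ex[OF ex1_implies_ex[OF assms(1)]]
    by (simp add: alpha_hat0_def arg_min_on_def arg_min_def)
  then show ?thesis using assms(2) by (simp add: is_arg_min_linorder)
qed

lemma is_arg_min_alpha_hat:
  assumes "\<exists>!\<alpha>. is_arg_min (hamiltonian q f t i i0 x v) (\<lambda>\<alpha>. \<alpha> \<in> A) \<alpha>"
    and "\<alpha> \<in> A"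
  shows "hamiltonian q f t i i0 x v (alpha_hat A q f t i i0 x v) \<le> hamiltonian q f t i i0 x v \<alpha>"
proof -
  have "is_arg_min (hamiltonian q f t i i0 x v) (\<lambda>\<alpha>. \<alpha> \<in> A) (alpha_hat A q f t i i0 x v)"
    using someI_ex[OF ex1_implies_ex[OF assms(1)]]
    by (simp add: alpha_hat_def arg_min_on_def arg_min_def)
  then show ?thesis using assms(2) by (simp add: is_arg_min_linorder)
qed

text \<open>
  The feedback under optimization enters the generator through the jump rates of its own player only:
  the drift of \<open>\<mu>\<close> is driven by the feedback of the population, and \<open>q\<close> does not see the major
  player's control. Hence changing it changes generator plus running cost by a difference of
  Hamiltonians. In the minor player's problem this uses that the deviating \<open>\<psi>\<close> and the population's
  \<open>\<phi>\<close> are separate arguments of \<^const>\<open>gen\<close>.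
\<close>

lemma gen0_change_control:
  "gen0 T q0 q \<psi>0 \<phi> F t i0 x + f0 t i0 (\<psi>0 t i0 x) x
     - (gen0 T q0 q \<phi>0 \<phi> F t i0 x + f0 t i0 (\<phi>0 t i0 x) x)
   = hamiltonian0 q0 f0 t i0 x (\<chi> j0. F t j0 x) (\<psi>0 t i0 x)
     - hamiltonian0 q0 f0 t i0 x (\<chi> j0. F t j0 x) (\<phi>0 t i0 x)"
  by (simp add: gen0_def hamiltonian0_def)

lemma gen_change_control:
  "gen T q0 q \<phi>0 \<phi> \<psi> F t (i, i0) x + f t i (\<psi> t i i0 x) i0 x
     - (gen T q0 q \<phi>0 \<phi> \<psi>' F t (i, i0) x + f t i (\<psi>' t i i0 x) i0 x)
   = hamiltonian q f t i i0 x (\<chi> j. \<chi> j0. F t (j, j0) x) (\<psi> t i i0 x)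
     - hamiltonian q f t i i0 x (\<chi> j. \<chi> j0. F t (j, j0) x) (\<psi>' t i i0 x)"
  by (simp add: hamiltonian_def)

section \<open>The Nash equilibrium\<close>

theorem theorem7:
  fixes T :: real
    and A0 :: "'a::real_normed_vector set"
    and A :: "'b::real_normed_vector set"
    and q0 :: "real \<Rightarrow> 'k::finite \<Rightarrow> 'k \<Rightarrow> 'a \<Rightarrow> real ^ 'm::finite \<Rightarrow> real"
    and q :: "real \<Rightarrow> 'm option \<Rightarrow> 'm option \<Rightarrow> 'b \<Rightarrow> 'k \<Rightarrow> real ^ 'm \<Rightarrow> real"
    and f0 :: "real \<Rightarrow> 'k \<Rightarrow> 'a \<Rightarrow> real ^ 'm \<Rightarrow> real"
    and g0 :: "'k \<Rightarrow> real ^ 'm \<Rightarrow> real"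
    and f :: "real \<Rightarrow> 'm option \<Rightarrow> 'b \<Rightarrow> 'k \<Rightarrow> real ^ 'm \<Rightarrow> real"
    and g :: "'m option \<Rightarrow> 'k \<Rightarrow> real ^ 'm \<Rightarrow> real"
    and Pr0 :: "('m, 'k, 'a) feedback0 \<Rightarrow> ('m, 'k, 'b) feedback \<Rightarrow>
      real \<Rightarrow> 'k \<times> (real ^ 'm) \<Rightarrow> 'w0 measure"
    and Z0 :: "('m, 'k, 'a) feedback0 \<Rightarrow> ('m, 'k, 'b) feedback \<Rightarrow>
      real \<Rightarrow> 'w0 \<Rightarrow> 'k \<times> (real ^ 'm)"
    and Pr :: "('m, 'k, 'a) feedback0 \<Rightarrow> ('m, 'k, 'b) feedback \<Rightarrow> ('m, 'k, 'b) feedback \<Rightarrow>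
      real \<Rightarrow> ('m option \<times> 'k) \<times> (real ^ 'm) \<Rightarrow> 'w measure"
    and Z :: "('m, 'k, 'a) feedback0 \<Rightarrow> ('m, 'k, 'b) feedback \<Rightarrow> ('m, 'k, 'b) feedback \<Rightarrow>
      real \<Rightarrow> 'w \<Rightarrow> ('m option \<times> 'k) \<times> (real ^ 'm)"
    and \<phi>0 :: "('m, 'k, 'a) feedback0"
    and \<phi> :: "('m, 'k, 'b) feedback"
    and V0 :: "real \<Rightarrow> 'k \<Rightarrow> real ^ 'm \<Rightarrow> real"
    and V :: "real \<Rightarrow> 'm option \<times> 'k \<Rightarrow> real ^ 'm \<Rightarrow> real"
  assumes data: "mfg_data T A0 A q0 q f0 g0 f g"
    and process0: "\<And>\<psi>0 \<psi>. \<lbrakk>\<psi>0 \<in> admissible0 T A0; \<psi> \<in> admissible T A\<rbrakk> \<Longrightarrow>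
      markov_process T (Pr0 \<psi>0 \<psi>) (Z0 \<psi>0 \<psi>) \<and>
      has_space_time_generator T (Pr0 \<psi>0 \<psi>) (Z0 \<psi>0 \<psi>) (gen0 T q0 q \<psi>0 \<psi>)"
    and process: "\<And>\<psi>0 \<psi> \<psi>b.
      \<lbrakk>\<psi>0 \<in> admissible0 T A0; \<psi> \<in> admissible T A; \<psi>b \<in> admissible T A\<rbrakk> \<Longrightarrow>
      markov_process T (Pr \<psi>0 \<psi> \<psi>b) (Z \<psi>0 \<psi> \<psi>b) \<and>
      has_space_time_generator T (Pr \<psi>0 \<psi> \<psi>b) (Z \<psi>0 \<psi> \<psi>b) (gen T q0 q \<psi>0 \<psi> \<psi>b)"
    and minimizer0: "\<And>i0 t x v0. \<lbrakk>t \<in> {0..T}; x \<in> subsimplex\<rbrakk> \<Longrightarrow>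
      \<exists>!\<alpha>0. is_arg_min (hamiltonian0 q0 f0 t i0 x v0) (\<lambda>\<alpha>0. \<alpha>0 \<in> A0) \<alpha>0"
    and minimizer0_lipschitz: "\<exists>K. \<forall>i0. K-lipschitz_on ({0..T} \<times> subsimplex \<times> UNIV)
      (\<lambda>(t, x, v0). alpha_hat0 A0 q0 f0 t i0 x v0)"
    and minimizer: "\<And>i i0 t x v. \<lbrakk>t \<in> {0..T}; x \<in> subsimplex\<rbrakk> \<Longrightarrow>
      \<exists>!\<alpha>. is_arg_min (hamiltonian q f t i i0 x v) (\<lambda>\<alpha>. \<alpha> \<in> A) \<alpha>"
    and minimizer_lipschitz: "\<exists>K. \<forall>i i0. K-lipschitz_on ({0..T} \<times> subsimplex \<times> UNIV)
      (\<lambda>(t, x, v). alpha_hat A q f t i i0 x v)"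
    and range0: "\<And>t i0 x. \<lbrakk>t \<in> {0..T}; x \<in> subsimplex\<rbrakk> \<Longrightarrow> \<phi>0 t i0 x \<in> A0"
    and range: "\<And>t i i0 x. \<lbrakk>t \<in> {0..T}; x \<in> subsimplex\<rbrakk> \<Longrightarrow> \<phi> t i i0 x \<in> A"
    and classical0: "C1 T V0"
    and classical: "C1 T V"
    and pde0: "\<And>t i0 x. \<lbrakk>t \<in> {0..T}; x \<in> subsimplex\<rbrakk> \<Longrightarrow>
      0 = gen0 T q0 q \<phi>0 \<phi> V0 t i0 x + f0 t i0 (\<phi>0 t i0 x) x"
    and terminal0: "\<And>i0 x. x \<in> subsimplex \<Longrightarrow> V0 T i0 x = g0 i0 x"
    and pde: "\<And>t i i0 x. \<lbrakk>t \<in> {0..T}; x \<in> subsimplex\<rbrakk> \<Longrightarrow>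
      0 = gen T q0 q \<phi>0 \<phi> \<phi> V t (i, i0) x + f t i (\<phi> t i i0 x) i0 x"
    and terminal: "\<And>i i0 x. x \<in> subsimplex \<Longrightarrow> V T (i, i0) x = g i i0 x"
    and feedback0: "\<And>t i0 x. \<lbrakk>t \<in> {0..T}; x \<in> subsimplex\<rbrakk> \<Longrightarrow>
      \<phi>0 t i0 x = alpha_hat0 A0 q0 f0 t i0 x (\<chi> j0. V0 t j0 x)"
    and feedback: "\<And>t i i0 x. \<lbrakk>t \<in> {0..T}; x \<in> subsimplex\<rbrakk> \<Longrightarrow>
      \<phi> t i i0 x = alpha_hat A q f t i i0 x (\<chi> j. \<chi> j0. V t (j, j0) x)"
  shows "nash_equilibrium T A0 A (cost0 T f0 g0 Pr0 Z0) (cost T f g Pr Z) \<phi>0 \<phi> \<and>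
    (\<forall>i0. \<forall>x\<in>subsimplex. V0 0 i0 x = cost0 T f0 g0 Pr0 Z0 \<phi>0 \<phi> 0 i0 x) \<and>
    (\<forall>i i0. \<forall>x\<in>subsimplex. V 0 (i, i0) x = cost T f g Pr Z \<phi>0 \<phi> \<phi> 0 i i0 x)"
proof -
  interpret mfg_data T A0 A q0 q f0 g0 f g by (rule data)
  \<comment> \<open>The candidate feedbacks are Lipschitz: the minimizers and the value functions are.\<close>
  have adm0: "\<phi>0 \<in> admissible0 T A0"
  proof -
    obtain K where K: "\<And>i0. K-lipschitz_on ({0..T} \<times> subsimplex \<times> UNIV)
        (\<lambda>(t, x, v0). alpha_hat0 A0 q0 f0 t i0 x v0)"
      using minimizer0_lipschitz by blast
    obtain L where L: "\<And>d. L-lipschitz_on ({0..T} \<times> subsimplex) (\<lambda>(t, x). V0 t d x)"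
      using C1_imp_lipschitz[OF classical0] by blast
    have "(real CARD('k) * L)-lipschitz_on ({0..T} \<times> subsimplex) (\<lambda>p. \<chi> j0. V0 (fst p) j0 (snd p))"
      using L by (intro lipschitz_on_vec_lambda) (simp add: case_prod_beta)
    note lip = lipschitz_on_feedback[OF K this]
    have "\<exists>K. \<forall>i0. K-lipschitz_on ({0..T} \<times> subsimplex) (\<lambda>(t, x). \<phi>0 t i0 x)"
      by (intro exI allI, rule lip) (simp add: feedback0)
    then show ?thesis using range0 by (simp add: admissible0_def)
  qed
  have adm: "\<phi> \<in> admissible T A"
  proof -
    obtain K where K: "\<And>i i0. K-lipschitz_on ({0..T} \<times> subsimplex \<times> UNIV)
        (\<lambda>(t, x, v). alpha_hat A q f t i i0 x v)"
      using minimizer_lipschitz by blast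
    obtain L where L: "\<And>d. L-lipschitz_on ({0..T} \<times> subsimplex) (\<lambda>(t, x). V t d x)"
      using C1_imp_lipschitz[OF classical] by blast
    have "(real CARD('m option) * (real CARD('k) * L))-lipschitz_on ({0..T} \<times> subsimplex)
        (\<lambda>p. \<chi> j. \<chi> j0. V (fst p) (j, j0) (snd p))"
      using L by (intro lipschitz_on_vec_lambda) (simp add: case_prod_beta)
    note lip = lipschitz_on_feedback[OF K this]
    have "\<exists>K. \<forall>i i0. K-lipschitz_on ({0..T} \<times> subsimplex) (\<lambda>(t, x). \<phi> t i i0 x)"
      by (intro exI allI, rule lip) (simp add: feedback)
    then show ?thesis using range by (simp add: admissible_def)
  qed
  have equilibrium0: "cost0 T f0 g0 Pr0 Z0 \<phi>0 \<phi> t i0 x = V0 t i0 x"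
    if "t \<in> {0..T}" "x \<in> subsimplex" for t i0 x
    using process0[OF adm0 adm] that
    by (intro cost0_verification(2) adm0 adm classical0 terminal0 pde0[symmetric]) auto
  have equilibrium: "cost T f g Pr Z \<phi>0 \<phi> \<phi> t i i0 x = V t (i, i0) x"
    if "t \<in> {0..T}" "x \<in> subsimplex" for t i i0 x
    using process[OF adm0 adm adm] that
    by (intro cost_verification(2) adm0 adm classical terminal pde[symmetric]) auto
  \<comment> \<open>\<open>\<phi>0\<close> minimizes the Hamiltonian pointwise, so along any other feedback the equation for \<open>V0\<close>
    becomes an inequality.\<close>
  have lower0: "V0 t i0 x \<le> cost0 T f0 g0 Pr0 Z0 \<psi>0 \<phi> t i0 x"
    if t: "t \<in> {0..T}" and x: "x \<in> subsimplex" and \<psi>0: "\<psi>0 \<in> admissible0 T A0" for t i0 x \<psi>0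
  proof (rule cost0_verification(1)[OF \<psi>0 adm _ _ classical0 terminal0 t x])
    fix s j0 and y :: "real ^ 'm" assume s: "s \<in> {0..T}" and y: "y \<in> subsimplex"
    then have "\<psi>0 s j0 y \<in> A0" using \<psi>0 by (simp add: admissible0_def)
    from is_arg_min_alpha_hat0[OF minimizer0[OF s y] this]
    have "hamiltonian0 q0 f0 s j0 y (\<chi> j0. V0 s j0 y) (\<phi>0 s j0 y)
        \<le> hamiltonian0 q0 f0 s j0 y (\<chi> j0. V0 s j0 y) (\<psi>0 s j0 y)"
      by (simp add: feedback0[OF s y])
    then show "0 \<le> gen0 T q0 q \<psi>0 \<phi> V0 s j0 y + f0 s j0 (\<psi>0 s j0 y) y"
      using gen0_change_control[of T q0 q \<psi>0 \<phi> V0 s j0 y f0 \<phi>0] pde0[OF s y, of j0] by linarith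
  qed (use process0[OF \<psi>0 adm] in auto)
  have lower: "V t (i, i0) x \<le> cost T f g Pr Z \<phi>0 \<phi> \<psi> t i i0 x"
    if t: "t \<in> {0..T}" and x: "x \<in> subsimplex" and \<psi>: "\<psi> \<in> admissible T A" for t i i0 x \<psi>
  proof (rule cost_verification(1)[OF adm0 adm \<psi> _ _ classical terminal t x])
    fix s j j0 and y :: "real ^ 'm" assume s: "s \<in> {0..T}" and y: "y \<in> subsimplex"
    then have "\<psi> s j j0 y \<in> A" using \<psi> by (simp add: admissible_def)
    from is_arg_min_alpha_hat[OF minimizer[OF s y] this]
    have "hamiltonian q f s j j0 y (\<chi> j. \<chi> j0. V s (j, j0) y) (\<phi> s j j0 y)
        \<le> hamiltonian q f s j j0 y (\<chi> j. \<chi> j0. V s (j, j0) y) (\<psi> s j j0 y)"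
      by (simp add: feedback[OF s y])
    then show "0 \<le> gen T q0 q \<phi>0 \<phi> \<psi> V s (j, j0) y + f s j (\<psi> s j j0 y) j0 y"
      using gen_change_control[of T q0 q \<phi>0 \<phi> \<psi> V s j j0 y f \<phi>] pde[OF s y, of j j0] by linarith
  qed (use process[OF adm0 adm \<psi>] in auto)
  have "nash_equilibrium T A0 A (cost0 T f0 g0 Pr0 Z0) (cost T f g Pr Z) \<phi>0 \<phi>"
    unfolding nash_equilibrium_def
  proof (intro conjI ballI allI adm0 adm)
    fix t i0 and x :: "real ^ 'm" assume t: "t \<in> {0..T}" and x: "x \<in> subsimplex"
    show "ereal (cost0 T f0 g0 Pr0 Z0 \<phi>0 \<phi> t i0 x)
        = (INF \<psi>0\<in>admissible0 T A0. ereal (cost0 T f0 g0 Pr0 Z0 \<psi>0 \<phi> t i0 x))"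
      using lower0[OF t x] adm0 by (intro antisym INF_greatest INF_lower) (auto simp: equilibrium0[OF t x])
    fix i
    show "ereal (cost T f g Pr Z \<phi>0 \<phi> \<phi> t i i0 x)
        = (INF \<psi>\<in>admissible T A. ereal (cost T f g Pr Z \<phi>0 \<phi> \<psi> t i i0 x))"
      using lower[OF t x] adm by (intro antisym INF_greatest INF_lower) (auto simp: equilibrium[OF t x])
  qed
  then show ?thesis using equilibrium0 equilibrium T_pos by simp
qed

end
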